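(* Let $\mathcal{R}$ be an ergodic, discrete measure-preserving equivalence relation over a standard probability space $(X,\mu)$. Suppose that $\nu\in\mathrm{Prob}([\mathcal{R}])$ is countably supported and symmetric, and that $\mathcal{S}\leq\mathcal{R}$ is hyperfinite. Then $\rho(\mathcal{R},\nu)=\rho(\mathcal{R}/\mathcal{S},\nu)$.
   Context: An equivalence relation over $(X,\mu)$ is a Borel subset of $X\times X$ that is an equivalence relation; $[x]_{\mathcal{R}}$ is the class of $x$. $\mathcal{R}$ is discrete if a.e. class is countable, and then measure-preserving if $\int_X\sum_{y\in[x]_{\mathcal{R}}}f(x,y)\,d\mu(x)=\int_X\sum_{y\in[x]_{\mathcal{R}}}f(y,x)\,d\mu(x)$ for all Borel $f:\mathcal{R}\to[0,\infty]$. $\mathcal{S}\leq\mathcal{R}$ means $\mathcal{S}$ is a subequivalence relation. $\mathcal{S}$ is hyperfinite if $\mathcal{S}=\bigcup_n\mathcal{S}_n$ (up to null sets) for an increasing sequence of equivalence relations $\mathcal{S}_n$ almost all of whose classes are finite. $[\mathcal{R}]$ is the Polish group of bimeasurable bijections $\phi:X\to X$ with $\phi(x)\in[x]_{\mathcal{R}}$ a.e., modulo a.e. equality. A countably supported $\nu\in\mathrm{Prob}([\mathcal{R}])$ is symmetric if $\nu(\phi)=\nu(\phi^{-1})$ for all $\phi$. For a subrelation $\mathcal{S}$, $p_{n,x,\mathcal{S}}=\nu^{*n}(\{\phi:\phi(x)\in[x]_{\mathcal{S}}\})$ and $\rho(\mathcal{R}/\mathcal{S},\nu)=\lim_{n\to\infty}\big(\int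 p_{2n,x,\mathcal{S}}\,d\mu(x)\big)^{1/2n}$ (the limit exists). The spectral radius $\rho(\mathcal{R},\nu)$ is $\rho(\mathcal{R}/\mathcal{T},\nu)$ for the trivial relation $\mathcal{T}=\{(x,x):x\in X\}$. *)

theory Defs
  imports "HOL-Probability.Probability" "HOL-Algebra.Group"
begin

section \<open>Equivalence relations over a standard probability space\<close>

definition standard_borel :: "'a measure \<Rightarrow> bool" where
  "standard_borel M \<longleftrightarrow>
     (\<exists>T. completely_metrizable_space T \<and> second_countable T \<and> space M = topspace T \<and>
          sets M = sigma_sets (topspace T) {U. openin T U})"

definition standard_prob_space :: "'a measure \<Rightarrow> bool" where
  "standard_prob_space M \<longleftrightarrow> prob_space M \<and> standard_borel M"

definition eq_rel_over :: "'a measure \<Rightarrow> ('a \<times> 'a) set \<Rightarrow> bool" where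
  "eq_rel_over M R \<longleftrightarrow> equiv (space M) R \<and> R \<in> sets (M \<Otimes>\<^sub>M M)"

definition discrete_rel :: "'a measure \<Rightarrow> ('a \<times> 'a) set \<Rightarrow> bool" where
  "discrete_rel M R \<longleftrightarrow> (AE x in M. countable (R `` {x}))"

definition measure_preserving_rel :: "'a measure \<Rightarrow> ('a \<times> 'a) set \<Rightarrow> bool" where
  "measure_preserving_rel M R \<longleftrightarrow>
     (\<forall>f :: 'a \<times> 'a \<Rightarrow> ennreal. f \<in> borel_measurable (restrict_space (M \<Otimes>\<^sub>M M) R) \<longrightarrow>
        (\<integral>\<^sup>+x. (\<Sum>\<^sub>\<infinity>y\<in>R `` {x}. f (x, y)) \<partial>M) = (\<integral>\<^sup>+x. (\<Sum>\<^sub>\<infinity>y\<in>R `` {x}. f (y, x)) \<partial>M))"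

definition ergodic_rel :: "'a measure \<Rightarrow> ('a \<times> 'a) set \<Rightarrow> bool" where
  "ergodic_rel M R \<longleftrightarrow>
     (\<forall>A\<in>sets M. R `` A \<subseteq> A \<longrightarrow> measure M A = 0 \<or> measure M A = 1)"

text \<open>A subset of a discrete measure-preserving relation is null iff almost all of its sections
  are empty, so equality of relations up to null sets means equality of almost all classes.\<close>

definition hyperfinite_rel :: "'a measure \<Rightarrow> ('a \<times> 'a) set \<Rightarrow> bool" where
  "hyperfinite_rel M S \<longleftrightarrow>
     (\<exists>T :: nat \<Rightarrow> ('a \<times> 'a) set. incseq T \<and>
        (\<forall>n. eq_rel_over M (T n) \<and> (AE x in M. finite (T n `` {x}))) \<and>
        (AE x in M. S `` {x} = (\<Union>n. T n) `` {x}))"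


section \<open>The full group\<close>

definition full_autos :: "'a measure \<Rightarrow> ('a \<times> 'a) set \<Rightarrow> ('a \<Rightarrow> 'a) set" where
  "full_autos M R =
     {f \<in> measurable M M. bij_betw f (space M) (space M) \<and>
        the_inv_into (space M) f \<in> measurable M M \<and> (AE x in M. f x \<in> R `` {x})}"

definition ae_eq_rel :: "'a measure \<Rightarrow> ('a \<times> 'a) set \<Rightarrow> (('a \<Rightarrow> 'a) \<times> ('a \<Rightarrow> 'a)) set" where
  "ae_eq_rel M R =
     {(f, g). f \<in> full_autos M R \<and> g \<in> full_autos M R \<and> (AE x in M. f x = g x)}"

definition full_group :: "'a measure \<Rightarrow> ('a \<times> 'a) set \<Rightarrow> ('a \<Rightarrow> 'a) set monoid" where
  "full_group M R =
     \<lparr>carrier = full_autos M R // ae_eq_rel M R,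
      mult = (\<lambda>C D. \<Union>f\<in>C. \<Union>g\<in>D. ae_eq_rel M R `` {f \<circ> g}),
      one = ae_eq_rel M R `` {id}\<rparr>"

text \<open>Composition of classes is well defined, and \<open>full_group\<close> is a group, because the maps in
  \<open>full_autos\<close> preserve null sets (by the mass transport identity). In particular the
  library's \<open>inv\<close> is the class of the inverse map.\<close>

lemma standard_borel_diagonal:
  assumes "standard_borel M"
  shows "{(x, y). x \<in> space M \<and> x = y} \<in> sets (M \<Otimes>\<^sub>M M)"
proof -
  obtain T where T: "completely_metrizable_space T" "second_countable T" "space M = topspace T"
    "sets M = sigma_sets (topspace T) {U. openin T U}"
    using assms unfolding standard_borel_def by blast
  obtain B where B: "countable B" "\<And>V. V \<in> B \<Longrightarrow> openin T V"
    "\<And>U x. openin T U \<Longrightarrow> x \<in> U \<Longrightarrow> \<exists>V\<in>B. x \<in> V \<and> V \<subseteq> U"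
    using T(2) unfolding second_countable_def by (elim exE conjE) metis
  have H: "Hausdorff_space T"
    using T(1) completely_metrizable_imp_metrizable_space metrizable_imp_Hausdorff_space by blast
  have Bs: "V \<in> sets M" if "V \<in> B" for V
    using B(2)[OF that] T(4) by auto
  let ?D = "{(x, y). x \<in> space M \<and> x = y}"
  let ?P = "{(U, V). U \<in> B \<and> V \<in> B \<and> U \<inter> V = {}}"
  have cP: "countable ?P"
    by (rule countable_subset[of _ "B \<times> B"]) (use B(1) in auto)
  have "?D = space (M \<Otimes>\<^sub>M M) - (\<Union>p\<in>?P. fst p \<times> snd p)"
  proof (intro equalityI subsetI)
    fix z assume "z \<in> ?D" then show "z \<in> space (M \<Otimes>\<^sub>M M) - (\<Union>p\<in>?P. fst p \<times> snd p)"
      by (auto simp: space_pair_measure)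
  next
    fix z assume z: "z \<in> space (M \<Otimes>\<^sub>M M) - (\<Union>p\<in>?P. fst p \<times> snd p)"
    obtain x y where xy: "z = (x, y)" by (cases z)
    have s: "x \<in> space M" "y \<in> space M" using z xy by (auto simp: space_pair_measure)
    have "x = y"
    proof (rule ccontr)
      assume "x \<noteq> y"
      then obtain U V where UV: "openin T U" "openin T V" "x \<in> U" "y \<in> V" "disjnt U V"
        using H s T(3) unfolding Hausdorff_space_def by metis
      obtain U' V' where "U' \<in> B" "x \<in> U'" "U' \<subseteq> U" "V' \<in> B" "y \<in> V'" "V' \<subseteq> V"
        using B(3)[OF UV(1,3)] B(3)[OF UV(2,4)] by blast
      then have "(U', V') \<in> ?P" "z \<in> U' \<times> V'" using UV(5) xy by (auto simp: disjnt_def)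
      then show False using z by force
    qed
    then show "z \<in> ?D" using xy s by auto
  qed
  also have "\<dots> \<in> sets (M \<Otimes>\<^sub>M M)"
    by (intro sets.Diff sets.top sets.countable_UN'' cP) (auto intro!: pair_measureI Bs)
  finally show ?thesis .
qed

context
  fixes M :: "'a measure" and R :: "('a \<times> 'a) set"
  assumes M: "standard_prob_space M" and R: "eq_rel_over M R" "measure_preserving_rel M R"
begin

lemma full_autos_push:
  assumes f: "f \<in> full_autos M R" and A: "A \<in> sets M"
  shows "emeasure M {x \<in> space M. f x \<in> A \<and> f x \<in> R `` {x}} =
    emeasure M {y \<in> space M. y \<in> A \<and> the_inv_into (space M) f y \<in> R `` {y}}"
proof -
  let ?g = "the_inv_into (space M) f"
  have fm[measurable]: "f \<in> measurable M M" and bij: "bij_betw f (space M) (space M)"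
    and gm[measurable]: "?g \<in> measurable M M"
    using f by (auto simp: full_autos_def)
  note A[measurable]
  have Rm[measurable]: "R \<in> sets (M \<Otimes>\<^sub>M M)" and eq: "equiv (space M) R" using R by (auto simp: eq_rel_over_def)
  have Rsub: "R \<subseteq> space M \<times> space M" and sy: "sym R" using eq by (auto simp: equiv_def)
  have D[measurable]: "{(x, y). x \<in> space M \<and> x = y} \<in> sets (M \<Otimes>\<^sub>M M)"
    using M standard_borel_diagonal by (auto simp: standard_prob_space_def)
  let ?G = "{z \<in> space (M \<Otimes>\<^sub>M M). (f (fst z), snd z) \<in> {(x, y). x \<in> space M \<and> x = y} \<and> snd z \<in> A}"
  have G: "?G \<in> sets (M \<Otimes>\<^sub>M M)" by measurable
  have Geq: "(x, y) \<in> ?G \<longleftrightarrow> y = f x \<and> y \<in> A" if "(x, y) \<in> R" for x y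
    using that Rsub measurable_space[OF fm] by (auto simp: space_pair_measure)
  have ind: "indicator ?G \<in> borel_measurable (restrict_space (M \<Otimes>\<^sub>M M) R)"
    using G by (intro measurable_restrict_space1) auto
  from R(2) ind have "(\<integral>\<^sup>+x. (\<Sum>\<^sub>\<infinity>y\<in>R `` {x}. indicator ?G (x, y)) \<partial>M)
      = (\<integral>\<^sup>+x. (\<Sum>\<^sub>\<infinity>y\<in>R `` {x}. (indicator ?G (y, x) :: ennreal)) \<partial>M)"
    unfolding measure_preserving_rel_def by blast
  also have "(\<integral>\<^sup>+x. (\<Sum>\<^sub>\<infinity>y\<in>R `` {x}. indicator ?G (x, y)) \<partial>M) =
     (\<integral>\<^sup>+x. indicator {x \<in> space M. f x \<in> A \<and> (x, f x) \<in> R} x \<partial>M)"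
  proof (rule nn_integral_cong)
    fix x assume x: "x \<in> space M"
    have "(\<Sum>\<^sub>\<infinity>y\<in>R `` {x}. (indicator ?G (x, y) :: ennreal))
      = (\<Sum>\<^sub>\<infinity>y\<in>(if f x \<in> A \<and> (x, f x) \<in> R then {f x} else {}). 1)"
      by (rule infsum_cong_neutral) (use Geq in \<open>auto split: if_splits simp: indicator_def\<close>)
    also have "\<dots> = indicator {x \<in> space M. f x \<in> A \<and> (x, f x) \<in> R} x" using x by (auto simp: indicator_def)
    finally show "(\<Sum>\<^sub>\<infinity>y\<in>R `` {x}. (indicator ?G (x, y) :: ennreal)) = indicator {x \<in> space M. f x \<in> A \<and> (x, f x) \<in> R} x" .
  qed
  also have "(\<integral>\<^sup>+x. (\<Sum>\<^sub>\<infinity>y\<in>R `` {x}. indicator ?G (y, x)) \<partial>M) =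
     (\<integral>\<^sup>+x. indicator {y \<in> space M. y \<in> A \<and> (y, ?g y) \<in> R} x \<partial>M)"
  proof (rule nn_integral_cong)
    fix x assume x: "x \<in> space M"
    have *: "x = f y \<longleftrightarrow> y = ?g x" if "y \<in> space M" for y
      using that x bij by (metis bij_betw_def f_the_inv_into_f the_inv_into_f_f)
    have "(\<Sum>\<^sub>\<infinity>y\<in>R `` {x}. (indicator ?G (y, x) :: ennreal))
      = (\<Sum>\<^sub>\<infinity>y\<in>(if x \<in> A \<and> (x, ?g x) \<in> R then {?g x} else {}). 1)"
    proof (rule infsum_cong_neutral)
      fix y assume "y \<in> R `` {x} - (if x \<in> A \<and> (x, ?g x) \<in> R then {?g x} else {})"
      then have "(x, y) \<in> R" "(y, x) \<in> R" "y \<in> space M" "x \<in> A \<longrightarrow> y \<noteq> ?g x"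
        using Rsub sy by (auto split: if_splits dest: symD)
      then show "(indicator ?G (y, x) :: ennreal) = 0" using Geq[of y x] *[of y] by (simp add: indicator_def) (metis)?
    next
      fix y assume "y \<in> R `` {x} \<inter> (if x \<in> A \<and> (x, ?g x) \<in> R then {?g x} else {})"
      then have "(x, y) \<in> R" "(y, x) \<in> R" "y \<in> space M" "x \<in> A" "y = ?g x"
        using Rsub sy by (auto split: if_splits dest: symD)
      then show "(indicator ?G (y, x) :: ennreal) = 1" using Geq[of y x] *[of y] by (simp add: indicator_def) (metis)?
    qed (auto split: if_splits)
    also have "\<dots> = indicator {y \<in> space M. y \<in> A \<and> (y, ?g y) \<in> R} x" using x by (auto simp: indicator_def)
    finally show "(\<Sum>\<^sub>\<infinity>y\<in>R `` {x}. (indicator ?G (y, x) :: ennreal)) = indicator {y \<in> space M. y \<in> A \<and> (y, ?g y) \<in> R} x" .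
  qed
  finally show ?thesis by simp
qed

lemma full_autos_AE:
  assumes f: "f \<in> full_autos M R" and P: "AE x in M. P x"
  shows "AE x in M. P (f x)"
proof -
  have fm[measurable]: "f \<in> measurable M M" and fR: "AE x in M. f x \<in> R `` {x}"
    using f by (auto simp: full_autos_def)
  have Rm[measurable]: "R \<in> sets (M \<Otimes>\<^sub>M M)" using R by (auto simp: eq_rel_over_def)
  obtain N where N: "N \<in> null_sets M" "{x \<in> space M. \<not> P x} \<subseteq> N"
    using P by (auto elim!: AE_E simp: null_sets_def)
  have Nm[measurable]: "N \<in> sets M" using N by auto
  have "emeasure M {y \<in> space M. y \<in> N \<and> the_inv_into (space M) f y \<in> R `` {y}} \<le> emeasure M N"
    by (intro emeasure_mono) auto
  then have "emeasure M {x \<in> space M. f x \<in> N \<and> f x \<in> R `` {x}} = 0"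
    using full_autos_push[OF f Nm] N by auto
  moreover have "{x \<in> space M. f x \<in> N \<and> f x \<in> R `` {x}} \<in> sets M" by simp
  ultimately have "AE x in M. x \<notin> {x \<in> space M. f x \<in> N \<and> f x \<in> R `` {x}}"
    by (intro AE_not_in) auto
  with fR show ?thesis
    using AE_space
  proof eventually_elim
    case (elim x)
    then have "f x \<in> space M" using measurable_space[OF fm] by simp
    then show ?case using elim N(2) by auto
  qed
qed

lemma full_autos_inv:
  assumes f: "f \<in> full_autos M R"
  shows "the_inv_into (space M) f \<in> full_autos M R"
proof -
  interpret prob_space M using M by (simp add: standard_prob_space_def)
  let ?g = "the_inv_into (space M) f"
  have fm[measurable]: "f \<in> measurable M M" and bij: "bij_betw f (space M) (space M)"
    and gm[measurable]: "?g \<in> measurable M M" and fR: "AE x in M. f x \<in> R `` {x}"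
    using f by (auto simp: full_autos_def)
  have Rm[measurable]: "R \<in> sets (M \<Otimes>\<^sub>M M)" using R by (auto simp: eq_rel_over_def)
  have bg: "bij_betw ?g (space M) (space M)" using bij by (rule bij_betw_the_inv_into)
  have gg: "the_inv_into (space M) ?g x = f x" if "x \<in> space M" for x
    using that bij bg by (metis bij_betw_def bij_betwE the_inv_into_f_f)
  have "emeasure M {x \<in> space M. f x \<in> space M \<and> f x \<in> R `` {x}} = 1"
  proof -
    have "AE x in M. f x \<in> space M \<and> f x \<in> R `` {x}" using fR measurable_space[OF fm] by auto
    then show ?thesis by (subst emeasure_eq_1_AE) auto
  qed
  then have 1: "emeasure M {y \<in> space M. ?g y \<in> R `` {y}} = 1"
    using full_autos_push[OF f sets.top] by (simp cong: conj_cong)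
  have "AE y in M. ?g y \<in> R `` {y}"
    using 1 AE_iff_emeasure_eq_1[of "\<lambda>y. ?g y \<in> R `` {y}"] by simp
  moreover have "the_inv_into (space M) ?g \<in> measurable M M"
    using fm gg by (simp cong: measurable_cong)
  ultimately show ?thesis using bg gm by (simp add: full_autos_def)
qed

lemma full_autos_comp:
  assumes f: "f \<in> full_autos M R" and g: "g \<in> full_autos M R"
  shows "f \<circ> g \<in> full_autos M R"
proof -
  let ?X = "space M"
  have fb: "bij_betw f ?X ?X" and gb: "bij_betw g ?X ?X" using f g by (auto simp: full_autos_def)
  have meas: "f \<in> measurable M M" "g \<in> measurable M M" "the_inv_into ?X f \<in> measurable M M"
     "the_inv_into ?X g \<in> measurable M M" using f g by (auto simp: full_autos_def)
  have b: "bij_betw (f \<circ> g) ?X ?X" using fb gb bij_betw_trans by blast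
  have "the_inv_into ?X (f \<circ> g) x = (the_inv_into ?X g \<circ> the_inv_into ?X f) x" if x: "x \<in> ?X" for x
  proof -
    have "the_inv_into ?X g (the_inv_into ?X f x) \<in> ?X"
      using x meas(3,4) by (meson measurable_space)
    moreover have "(f \<circ> g) (the_inv_into ?X g (the_inv_into ?X f x)) = x"
      using x fb gb meas(3) by (simp add: bij_betw_def f_the_inv_into_f measurable_space)
    ultimately show ?thesis using b by (metis bij_betw_def comp_apply the_inv_into_f_f)
  qed
  then have im: "the_inv_into ?X (f \<circ> g) \<in> measurable M M"
    using measurable_comp[OF meas(3,4)] by (simp cong: measurable_cong)
  have "AE x in M. f x \<in> R `` {x}" "AE x in M. g x \<in> R `` {x}" using f g by (auto simp: full_autos_def)
  then have "AE x in M. f (g x) \<in> R `` {g x}" "AE x in M. g x \<in> R `` {x}" using full_autos_AE[OF g] by blast+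
  then have "AE x in M. (f \<circ> g) x \<in> R `` {x}"
    by eventually_elim (use R in \<open>auto simp: eq_rel_over_def equiv_def dest: transD\<close>)
  then show ?thesis using b im measurable_comp[OF meas(2,1)] by (simp add: full_autos_def)
qed

lemma full_autos_id: "id \<in> full_autos M R"
proof -
  have "the_inv_into (space M) id x = x" if "x \<in> space M" for x
    using the_inv_into_f_f[of id "space M" x] that by simp
  then have "the_inv_into (space M) id \<in> measurable M M" by (simp cong: measurable_cong)
  moreover have "AE x in M. id x \<in> R `` {x}"
    using R by (intro AE_I2) (auto simp: eq_rel_over_def equiv_def refl_on_def)
  ultimately show ?thesis by (simp add: full_autos_def)
qed

lemma ae_eq_equiv: "equiv (full_autos M R) (ae_eq_rel M R)"
  by (rule equivI) (auto simp: ae_eq_rel_def refl_on_def sym_def trans_def elim: AE_mp)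

lemma ae_eq_comp: "(\<lambda>f g. ae_eq_rel M R `` {f \<circ> g}) respects2 (ae_eq_rel M R)"
proof (rule congruent2I[OF ae_eq_equiv ae_eq_equiv])
  fix f g h assume "(f, g) \<in> ae_eq_rel M R" "h \<in> full_autos M R"
  then have "(f \<circ> h, g \<circ> h) \<in> ae_eq_rel M R"
    using full_autos_AE[of h "\<lambda>x. f x = g x"] full_autos_comp by (auto simp: ae_eq_rel_def)
  then show "ae_eq_rel M R `` {f \<circ> h} = ae_eq_rel M R `` {g \<circ> h}"
    using ae_eq_equiv equiv_class_eq by fast
next
  fix f g h assume "(f, g) \<in> ae_eq_rel M R" "h \<in> full_autos M R"
  then have "(h \<circ> f, h \<circ> g) \<in> ae_eq_rel M R"
    using full_autos_comp by (auto simp: ae_eq_rel_def elim: AE_mp)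
  then show "ae_eq_rel M R `` {h \<circ> f} = ae_eq_rel M R `` {h \<circ> g}"
    using ae_eq_equiv equiv_class_eq by fast
qed

lemma full_group_mult:
  assumes "f \<in> full_autos M R" "g \<in> full_autos M R"
  shows "ae_eq_rel M R `` {f} \<otimes>\<^bsub>full_group M R\<^esub> ae_eq_rel M R `` {g} = ae_eq_rel M R `` {f \<circ> g}"
  using UN_equiv_class2[OF ae_eq_equiv ae_eq_equiv ae_eq_comp assms] by (simp add: full_group_def)

theorem group_full_group: "group (full_group M R)"
proof (rule groupI)
  let ?G = "full_group M R"
  have carr: "carrier ?G = full_autos M R // ae_eq_rel M R"
    and one: "\<one>\<^bsub>?G\<^esub> = ae_eq_rel M R `` {id}" by (simp_all add: full_group_def)
  show "\<one>\<^bsub>?G\<^esub> \<in> carrier ?G" unfolding carr one by (rule quotientI[OF full_autos_id])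
  fix C assume C: "C \<in> carrier ?G"
  then obtain f where f: "f \<in> full_autos M R" "C = ae_eq_rel M R `` {f}"
    unfolding carr by (auto elim: quotientE)
  show "\<one>\<^bsub>?G\<^esub> \<otimes>\<^bsub>?G\<^esub> C = C"
    unfolding one f(2) full_group_mult[OF full_autos_id f(1)] by simp
  have "(the_inv_into (space M) f \<circ> f, id) \<in> ae_eq_rel M R"
    using full_autos_comp[OF full_autos_inv[OF f(1)] f(1)] full_autos_id f(1)
    by (auto simp: ae_eq_rel_def full_autos_def bij_betw_def the_inv_into_f_f)
  then have "ae_eq_rel M R `` {the_inv_into (space M) f} \<otimes>\<^bsub>?G\<^esub> C = \<one>\<^bsub>?G\<^esub>"
    unfolding one f(2) full_group_mult[OF full_autos_inv[OF f(1)] f(1)]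
    using ae_eq_equiv equiv_class_eq by fast
  then show "\<exists>D\<in>carrier ?G. D \<otimes>\<^bsub>?G\<^esub> C = \<one>\<^bsub>?G\<^esub>"
    unfolding carr using quotientI[OF full_autos_inv[OF f(1)]] by blast
  fix D assume "D \<in> carrier ?G"
  then obtain g where g: "g \<in> full_autos M R" "D = ae_eq_rel M R `` {g}"
    unfolding carr by (auto elim: quotientE)
  show "C \<otimes>\<^bsub>?G\<^esub> D \<in> carrier ?G"
    unfolding f(2) g(2) full_group_mult[OF f(1) g(1)] carr
    by (rule quotientI[OF full_autos_comp[OF f(1) g(1)]])
  fix E assume "E \<in> carrier ?G"
  then obtain h where h: "h \<in> full_autos M R" "E = ae_eq_rel M R `` {h}"
    unfolding carr by (auto elim: quotientE)
  show "C \<otimes>\<^bsub>?G\<^esub> D \<otimes>\<^bsub>?G\<^esub> E = C \<otimes>\<^bsub>?G\<^esub> (D \<otimes>\<^bsub>?G\<^esub> E)"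
    using full_group_mult full_autos_comp f g h by (simp add: comp_assoc)
qed

end

text \<open>Countably supported probability measures on the full group are modelled as \<open>pmf\<close>s
  (which have countable support) whose support lies in the carrier.\<close>

definition countably_supported_prob :: "('b, 'c) monoid_scheme \<Rightarrow> 'b pmf \<Rightarrow> bool" where
  "countably_supported_prob G \<nu> \<longleftrightarrow> set_pmf \<nu> \<subseteq> carrier G"

definition symmetric_pmf :: "('b, 'c) monoid_scheme \<Rightarrow> 'b pmf \<Rightarrow> bool" where
  "symmetric_pmf G \<nu> \<longleftrightarrow> (\<forall>\<phi>\<in>carrier G. pmf \<nu> \<phi> = pmf \<nu> (inv\<^bsub>G\<^esub> \<phi>))"

primrec conv_power :: "('b, 'c) monoid_scheme \<Rightarrow> 'b pmf \<Rightarrow> nat \<Rightarrow> 'b pmf" where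
  "conv_power G \<nu> 0 = return_pmf \<one>\<^bsub>G\<^esub>"
| "conv_power G \<nu> (Suc n) = map_pmf (\<lambda>(\<phi>, \<psi>). \<phi> \<otimes>\<^bsub>G\<^esub> \<psi>) (pair_pmf \<nu> (conv_power G \<nu> n))"


section \<open>Spectral radii\<close>

text \<open>An element of the full group is a class of maps modulo a.e. equality; to evaluate it at
  a point a representative is chosen. Since a convolution power has countable support, another
  choice changes \<open>return_prob\<close> only on a null set of points \<open>x\<close>.\<close>

definition return_prob ::
    "'a measure \<Rightarrow> ('a \<times> 'a) set \<Rightarrow> ('a \<times> 'a) set \<Rightarrow> ('a \<Rightarrow> 'a) set pmf \<Rightarrow> nat \<Rightarrow> 'a \<Rightarrow> real" where
  "return_prob M R S \<nu> n x =
     measure_pmf.prob (conv_power (full_group M R) \<nu> n) {\<phi>. (SOME f. f \<in> \<phi>) x \<in> S `` {x}}"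

definition rel_spectral_radius ::
    "'a measure \<Rightarrow> ('a \<times> 'a) set \<Rightarrow> ('a \<times> 'a) set \<Rightarrow> ('a \<Rightarrow> 'a) set pmf \<Rightarrow> real" where
  "rel_spectral_radius M R S \<nu> =
     lim (\<lambda>n. (\<integral>x. return_prob M R S \<nu> (2 * n) x \<partial>M) powr (1 / real (2 * n)))"

definition spectral_radius ::
    "'a measure \<Rightarrow> ('a \<times> 'a) set \<Rightarrow> ('a \<Rightarrow> 'a) set pmf \<Rightarrow> real" where
  "spectral_radius M R \<nu> = rel_spectral_radius M R (Id_on (space M)) \<nu>"

end

theory Submission
  imports Defs
begin

text \<open>For an equivalence relation \<open>E\<close> let \<open>b\<^sub>E(n)\<close> be the average over \<open>x\<close> of the
  probability that \<open>2n\<close> steps of the random walk driven by \<open>\<nu>\<close> bring \<open>x\<close> back to its own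
  \<open>E\<close>-class, and let \<open>\<Delta>\<close> be the diagonal. The claim is that \<open>b\<^sub>\<Delta>\<close> and \<open>b\<^sub>S\<close> have the
  same exponential growth rate. Clearly \<open>b\<^sub>\<Delta> \<le> b\<^sub>S\<close>, so only an upper bound on \<open>b\<^sub>S\<close> is needed.

  The elements of the full group preserve the measure and \<open>\<nu>\<close> is symmetric, so the average
  probability that \<open>i + j\<close> steps return to the class is the average probability that two
  independent walks from a common starting point, of lengths \<open>i\<close> and \<open>j\<close>, end in the same
  \<open>E\<close>-class. As a function of the pair of walks this is an inner product of class distributions,
  which gives a Cauchy-Schwarz inequality (\<open>corr_cauchy_schwarz\<close>). Hence \<open>b\<^sub>E\<close> is log-convex with
  \<open>b\<^sub>E(0) = 1\<close>, so that \<open>b\<^sub>E(n)\<close> to the power \<open>1/2n\<close> is increasing in \<open>n \<ge> 1\<close>: the limit exists, and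
  it bounds every single term (\<open>log_convex_root_tendsto\<close>). Consequently, if \<open>b\<^sub>E \<le> C b\<^sub>\<Delta>\<close>
  for some constant \<open>C\<close>, then \<open>b\<^sub>E(n) \<le> \<rho>\<^sup>2\<^sup>n\<close> for all \<open>n\<close>, where \<open>\<rho>\<close> is the spectral radius. The
  constant has disappeared, so this bound survives increasing unions of relations
  (\<open>ret_exhaustion_le\<close>).

  It remains to exhaust \<open>S\<close> by relations that satisfy \<open>b\<^sub>E \<le> C b\<^sub>\<Delta>\<close>. By hyperfiniteness
  finite relations suffice. A finite relation is in turn, up to null sets, the increasing union of relations \<open>E\<close>
  such that, within an orbit of the walk, the class of any point \<open>x\<close> lies in
  \<open>{x, g\<^sub>0 x, \<dots>, g\<^sub>m\<^sub>-\<^sub>1 x}\<close> for fixed group elements \<open>g\<^sub>i\<close>. For these, \<open>b\<^sub>E(n)\<close> is at most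
  \<open>b\<^sub>\<Delta>(n)\<close> plus the sum over \<open>i\<close> of the probabilities that the walk acts on \<open>x\<close> as \<open>g\<^sub>i\<close> does,
  and by Cauchy-Schwarz each of these is at most \<open>b\<^sub>\<Delta>(n)\<close>, so that \<open>C = m + 1\<close> works
  (\<open>ret_trunc_le\<close>).\<close>

section \<open>Roots of log-convex sequences\<close>

lemma log_convex_power_le:
  fixes b :: "nat \<Rightarrow> real"
  assumes one: "b 0 = 1" and nonneg: "\<And>n. 0 \<le> b n"
    and lc: "\<And>n. (b (Suc n))\<^sup>2 \<le> b n * b (Suc (Suc n))"
  shows "b n ^ Suc n \<le> b (Suc n) ^ n"
proof (induction n)
  case 0
  show ?case using one by simp
next
  case (Suc n)
  show ?case
  proof (cases "b (Suc n) = 0")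
    case True
    then show ?thesis using nonneg by simp
  next
    case False
    then have pos: "0 < b (Suc n) ^ n" using nonneg[of "Suc n"] by simp
    \<comment> \<open>Raise log-convexity to the power \<open>n + 1\<close>, insert the induction hypothesis and cancel.\<close>
    have "b (Suc n) ^ n * b (Suc n) ^ Suc (Suc n) = ((b (Suc n))\<^sup>2) ^ Suc n"
      by (simp flip: power_mult power_add add: mult_2)
    also have "\<dots> \<le> (b n * b (Suc (Suc n))) ^ Suc n"
      using lc by (intro power_mono) auto
    also have "\<dots> = b n ^ Suc n * b (Suc (Suc n)) ^ Suc n"
      by (rule power_mult_distrib)
    also have "\<dots> \<le> b (Suc n) ^ n * b (Suc (Suc n)) ^ Suc n"
      using Suc.IH nonneg by (intro mult_right_mono) auto
    finally show ?thesis using pos by (simp del: power_Suc)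
  qed
qed

text \<open>The index starts at 1: the exponent for \<open>n = 0\<close> is \<open>1 / 0 = 0\<close>, so the root there is 1.\<close>

lemma log_convex_root_incseq:
  fixes b :: "nat \<Rightarrow> real"
  assumes one: "b 0 = 1" and nonneg: "\<And>n. 0 \<le> b n"
    and lc: "\<And>n. (b (Suc n))\<^sup>2 \<le> b n * b (Suc (Suc n))"
  shows "incseq (\<lambda>n. b (Suc n) powr (1 / real (2 * Suc n)))"
proof (rule incseq_SucI)
  fix k
  define n where "n = Suc k"
  have n: "0 < n" by (simp add: n_def)
  have "b n powr (1 / real (2 * n)) \<le> b (Suc n) powr (1 / real (2 * Suc n))"
  proof (cases "b n = 0")
    case False
    then have pos: "0 < b n" using nonneg[of n] by simp
    have le: "b n ^ Suc n \<le> b (Suc n) ^ n"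
      by (rule log_convex_power_le[OF one nonneg lc])
    have "0 < b n ^ Suc n" using pos by simp
    then have "b (Suc n) \<noteq> 0" using le n by (auto simp: zero_power)
    then have pos': "0 < b (Suc n)" using nonneg[of "Suc n"] by simp
    have cancel: "y * (1 / (2 * x * y)) = 1 / (2 * x)" "x * (1 / (2 * x * y)) = 1 / (2 * y)"
      if "0 < x" "0 < y" for x y :: real
      using that by auto
    define e where "e = 1 / (2 * real n * real (Suc n))"
    have e: "real (Suc n) * e = 1 / real (2 * n)" "real n * e = 1 / real (2 * Suc n)"
      unfolding e_def of_nat_mult of_nat_numeral using n by (intro cancel; simp)+
    have "b n powr (1 / real (2 * n)) = (b n ^ Suc n) powr e"
      using pos by (simp only: e(1)[symmetric] powr_powr[symmetric] powr_realpow)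
    also have "\<dots> \<le> (b (Suc n) ^ n) powr e"
      using le pos by (intro powr_mono2) (auto simp: e_def)
    also have "\<dots> = b (Suc n) powr (1 / real (2 * Suc n))"
      using pos' by (simp only: e(2)[symmetric] powr_powr[symmetric] powr_realpow)
    finally show ?thesis .
  qed simp
  then show "b (Suc k) powr (1 / real (2 * Suc k)) \<le> b (Suc (Suc k)) powr (1 / real (2 * Suc (Suc k)))"
    by (simp only: n_def)
qed

lemma log_convex_root_tendsto:
  fixes b :: "nat \<Rightarrow> real"
  assumes one: "b 0 = 1" and nonneg: "\<And>n. 0 \<le> b n" and le1: "\<And>n. b n \<le> 1"
    and lc: "\<And>n. (b (Suc n))\<^sup>2 \<le> b n * b (Suc (Suc n))"
  obtains r where "(\<lambda>n. b n powr (1 / real (2 * n))) \<longlonglongrightarrow> r" "0 \<le> r" "\<And>n. b n \<le> r ^ (2 * n)"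
proof -
  let ?s = "\<lambda>n. b n powr (1 / real (2 * n))"
  have inc: "incseq (\<lambda>n. ?s (Suc n))"
    by (rule log_convex_root_incseq[OF one nonneg lc])
  have "?s (Suc n) \<le> 1" for n
    using powr_mono2[of "1 / real (2 * Suc n)" "b (Suc n)" 1] nonneg le1 by simp
  then obtain r where r: "(\<lambda>n. ?s (Suc n)) \<longlonglongrightarrow> r" "\<And>n. ?s (Suc n) \<le> r"
    using incseq_convergent[OF inc] by blast
  have "0 \<le> ?s (Suc 0)" by simp
  then have r0: "0 \<le> r" using r(2)[of 0] by linarith
  have "b n \<le> r ^ (2 * n)" for n
  proof (cases n)
    case 0
    then show ?thesis using one by simp
  next
    case (Suc m)
    have n: "n \<noteq> 0" using Suc by simp
    have "b n = ?s n ^ (2 * n)"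
    proof (cases "b n = 0")
      case False
      then have "?s n ^ (2 * n) = b n powr (real (2 * n) * (1 / real (2 * n)))"
        by (rule powr_power)
      also have "\<dots> = b n" using n nonneg[of n] by simp
      finally show ?thesis ..
    qed (use n in simp)
    also have "\<dots> \<le> r ^ (2 * n)" using r(2)[of m] Suc by (intro power_mono) auto
    finally show ?thesis .
  qed
  moreover have "?s \<longlonglongrightarrow> r"
    by (rule iffD1[OF filterlim_sequentially_Suc[of ?s] r(1)])
  ultimately show ?thesis using that r0 by blast
qed

text \<open>By the preceding lemma each term of a log-convex sequence is bounded in terms of its growth
  rate, and the growth rate does not see the constant \<open>C\<close>.\<close>

lemma log_convex_absorb_constant:
  fixes a b :: "nat \<Rightarrow> real"
  assumes one: "b 0 = 1" and nonneg: "\<And>n. 0 \<le> b n" and le1: "\<And>n. b n \<le> 1"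
    and lc: "\<And>n. (b (Suc n))\<^sup>2 \<le> b n * b (Suc (Suc n))"
    and C: "0 < C" and a: "\<And>n. 0 \<le> a n" and le: "\<And>n. b n \<le> C * a n"
    and lim: "(\<lambda>n. a n powr (1 / real (2 * n))) \<longlonglongrightarrow> r"
  shows "b n \<le> r ^ (2 * n)"
proof -
  obtain s where s: "(\<lambda>n. b n powr (1 / real (2 * n))) \<longlonglongrightarrow> s" "0 \<le> s" "\<And>n. b n \<le> s ^ (2 * n)"
    using log_convex_root_tendsto[of b] one nonneg le1 lc by blast
  have "filterlim (\<lambda>n::nat. 2 * n) at_top sequentially"
    by (rule mult_nat_left_at_top) simp
  then have "(\<lambda>n. 1 / real (2 * n)) \<longlonglongrightarrow> 0"
    by (rule filterlim_compose[OF lim_1_over_n])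
  then have "(\<lambda>n. C powr (1 / real (2 * n))) \<longlonglongrightarrow> C powr 0"
    using C by (intro tendsto_powr tendsto_const) auto
  then have "(\<lambda>n. C powr (1 / real (2 * n)) * a n powr (1 / real (2 * n))) \<longlonglongrightarrow> C powr 0 * r"
    using lim by (intro tendsto_mult)
  moreover have "b n powr (1 / real (2 * n)) \<le> C powr (1 / real (2 * n)) * a n powr (1 / real (2 * n))" for n
    using powr_mono2[of "1 / real (2 * n)" "b n" "C * a n"] nonneg le C a by (simp add: powr_mult)
  ultimately have "s \<le> C powr 0 * r" using s(1) by (intro LIMSEQ_le) auto
  then have "s \<le> r" using C by simp
  then show ?thesis using s(3)[of n] power_mono[OF _ s(2), of r "2 * n"] by fastforce
qed

section \<open>Coincidence probabilities\<close>

lemma emeasure_coincidence: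
  fixes p q :: "'c pmf"
  shows "emeasure (pair_pmf p q) {(c, d). c = d} =
    (\<integral>\<^sup>+c. ennreal (pmf p c * pmf q c) \<partial>count_space UNIV)"
proof -
  have "emeasure (pair_pmf p q) {(c, d). c = d} = (\<integral>\<^sup>+z. indicator {(c, d). c = d} z \<partial>pair_pmf p q)"
    by simp
  also have "\<dots> = (\<integral>\<^sup>+c. \<integral>\<^sup>+d. indicator {(c, d). c = d} (c, d) \<partial>q \<partial>p)"
    by (rule nn_integral_pair_pmf')
  also have "\<dots> = (\<integral>\<^sup>+c. \<integral>\<^sup>+d. indicator {c} d \<partial>q \<partial>p)"
    by (intro nn_integral_cong) (auto simp: indicator_def)
  also have "\<dots> = (\<integral>\<^sup>+c. ennreal (pmf q c) \<partial>p)"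
    by (simp add: emeasure_pmf_single)
  finally show ?thesis
    by (simp add: nn_integral_measure_pmf ennreal_mult)
qed

text \<open>The quantity \<open>X p q\<close> is the inner product of the distributions of \<open>f\<close> under \<open>p\<close> and \<open>q\<close>.
  Its Cauchy-Schwarz inequality is stated with free weights \<open>u\<close>, \<open>v\<close>, because in this linear form
  it can be integrated over a parameter; \<open>amgm_family_imp_cauchy_schwarz\<close> recovers the
  quadratic form afterwards.\<close>

lemma prob_coincidence_amgm:
  fixes p q :: "'b pmf" and f :: "'b \<Rightarrow> 'c" and u v :: real
  assumes u: "0 \<le> u" and v: "0 \<le> v"
  defines "X \<equiv> \<lambda>p q. measure_pmf.prob (pair_pmf p q) {(a, b). f a = f b}"
  shows "2 * u * v * X p q \<le> u\<^sup>2 * X p p + v\<^sup>2 * X q q"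
proof -
  let ?m = "map_pmf f"
  define Y where "Y p q = (\<integral>\<^sup>+c. ennreal (pmf (?m p) c * pmf (?m q) c) \<partial>count_space UNIV)" for p q
  have XY: "ennreal (X p q) = Y p q" for p q
  proof -
    have "ennreal (X p q) = emeasure (pair_pmf p q) ((\<lambda>(a, b). (f a, f b)) -` {(c, d). c = d})"
      unfolding X_def measure_pmf.emeasure_eq_measure
      by (intro arg_cong[where f = ennreal] arg_cong[where f = "measure_pmf.prob _"]) auto
    also have "\<dots> = emeasure (pair_pmf (?m p) (?m q)) {(c, d). c = d}"
      by (simp flip: map_pair)
    finally show ?thesis by (simp add: emeasure_coincidence Y_def)
  qed
  have nn: "0 \<le> X p q" for p q by (simp add: X_def)
  have "ennreal (2 * u * v) * Y p q = (\<integral>\<^sup>+c. ennreal (2 * u * v * (pmf (?m p) c * pmf (?m q) c)) \<partial>count_space UNIV)"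
    unfolding Y_def using u v by (subst nn_integral_cmult[symmetric]) (auto simp: ennreal_mult)
  also have "\<dots> \<le> (\<integral>\<^sup>+c. ennreal (u\<^sup>2) * ennreal (pmf (?m p) c * pmf (?m p) c)
      + ennreal (v\<^sup>2) * ennreal (pmf (?m q) c * pmf (?m q) c) \<partial>count_space UNIV)"
  proof (rule nn_integral_mono)
    fix c
    let ?a = "pmf (?m p) c" and ?b = "pmf (?m q) c"
    have "0 \<le> (u * ?a - v * ?b)\<^sup>2" by simp
    then have "2 * u * v * (?a * ?b) \<le> u\<^sup>2 * (?a * ?a) + v\<^sup>2 * (?b * ?b)"
      by (simp add: power2_eq_square algebra_simps)
    then show "ennreal (2 * u * v * (?a * ?b)) \<le> ennreal (u\<^sup>2) * ennreal (?a * ?a) + ennreal (v\<^sup>2) * ennreal (?b * ?b)"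
      by (simp flip: ennreal_mult ennreal_plus add: ennreal_leI)
  qed
  also have "\<dots> = ennreal (u\<^sup>2) * Y p p + ennreal (v\<^sup>2) * Y q q"
    unfolding Y_def by (simp add: nn_integral_add nn_integral_cmult)
  finally have "ennreal (2 * u * v * X p q) \<le> ennreal (u\<^sup>2 * X p p + v\<^sup>2 * X q q)"
    using u v nn by (simp add: ennreal_mult ennreal_plus flip: XY)
  then show ?thesis using nn by (subst (asm) ennreal_le_iff) auto
qed

lemma amgm_family_imp_cauchy_schwarz:
  fixes a b c :: real
  assumes a: "0 \<le> a" and b: "0 \<le> b" and c: "0 \<le> c"
    and le: "\<And>u v. 0 \<le> u \<Longrightarrow> 0 \<le> v \<Longrightarrow> 2 * u * v * c \<le> u\<^sup>2 * a + v\<^sup>2 * b"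
  shows "c\<^sup>2 \<le> a * b"
proof (cases "a = 0")
  case False
  have "2 * c * a * c \<le> c\<^sup>2 * a + a\<^sup>2 * b" using le[of c a] a c by simp
  then have "a * c\<^sup>2 \<le> a * (a * b)" by (simp add: power2_eq_square algebra_simps)
  then show ?thesis using a False by simp
next
  case True
  have "2 * (b + 1) * c * c \<le> c\<^sup>2 * b" using le[of "b + 1" c] True b c by simp
  then have "(b + 2) * c\<^sup>2 \<le> 0" by (simp add: power2_eq_square algebra_simps)
  then have "c\<^sup>2 \<le> 0" using b by (simp add: mult_le_0_iff)
  then show ?thesis using True by simp
qed

text \<open>Fubini for a probability measure and a discrete distribution. Joint measurability is not
  required, since the support of a \<open>pmf\<close> is countable.\<close>

lemma (in prob_space)
  fixes p :: "'b pmf" and A :: "'b \<Rightarrow> 'a set"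
  assumes A: "\<And>i. i \<in> set_pmf p \<Longrightarrow> A i \<in> events"
  shows integrable_pmf_prob: "integrable M (\<lambda>x. measure_pmf.prob p {i. x \<in> A i})"
    and integral_pmf_prob: "(\<integral>x. measure_pmf.prob p {i. x \<in> A i} \<partial>M) = measure_pmf.expectation p (\<lambda>i. prob (A i))"
proof -
  let ?I = "set_pmf p"
  have eq: "ennreal (measure_pmf.prob p {i. x \<in> A i}) = (\<integral>\<^sup>+i. ennreal (pmf p i) * indicator (A i) x \<partial>count_space ?I)" for x
  proof -
    have "ennreal (measure_pmf.prob p {i. x \<in> A i}) = (\<integral>\<^sup>+i. indicator {i. x \<in> A i} i \<partial>p)"
      by (simp add: measure_pmf.emeasure_eq_measure)
    also have "\<dots> = (\<integral>\<^sup>+i. indicator (A i) x \<partial>p)"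
      by (intro nn_integral_cong) (simp add: indicator_def)
    also have "\<dots> = (\<integral>\<^sup>+i. ennreal (pmf p i) * indicator (A i) x \<partial>count_space UNIV)"
      by (rule nn_integral_measure_pmf)
    also have "\<dots> = (\<integral>\<^sup>+i. ennreal (pmf p i) * indicator (A i) x * indicator ?I i \<partial>count_space UNIV)"
      by (intro nn_integral_cong) (auto simp: indicator_def set_pmf_iff)
    finally show ?thesis by (simp add: nn_integral_count_space_indicator)
  qed
  have Am: "(\<lambda>x. ennreal (pmf p i) * indicator (A i) x) \<in> borel_measurable M" if "i \<in> ?I" for i
    using A[OF that] by simp
  have "(\<lambda>x. \<integral>\<^sup>+i. ennreal (pmf p i) * indicator (A i) x \<partial>count_space ?I) \<in> borel_measurable M"
  proof (rule sigma_finite_measure.borel_measurable_nn_integral)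
    show "sigma_finite_measure (count_space ?I)"
      by (rule sigma_finite_measure_count_space_countable) simp
    have "(\<lambda>z. ennreal (pmf p (fst z)) * indicator (A (fst z)) (snd z)) \<in> borel_measurable (count_space ?I \<Otimes>\<^sub>M M)"
      by (rule measurable_pair_measure_countable1) (use Am in auto)
    from measurable_compose[OF measurable_pair_swap' this]
    show "(\<lambda>(x, i). ennreal (pmf p i) * indicator (A i) x) \<in> borel_measurable (M \<Otimes>\<^sub>M count_space ?I)"
      by (simp add: case_prod_beta)
  qed
  then have "(\<lambda>x. enn2real (ennreal (measure_pmf.prob p {i. x \<in> A i}))) \<in> borel_measurable M"
    unfolding eq by simp
  then have meas: "(\<lambda>x. measure_pmf.prob p {i. x \<in> A i}) \<in> borel_measurable M" by simp
  show int: "integrable M (\<lambda>x. measure_pmf.prob p {i. x \<in> A i})"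
    by (rule integrable_const_bound[of _ 1]) (use meas in auto)
  have "ennreal (\<integral>x. measure_pmf.prob p {i. x \<in> A i} \<partial>M) = (\<integral>\<^sup>+x. ennreal (measure_pmf.prob p {i. x \<in> A i}) \<partial>M)"
    by (rule nn_integral_eq_integral[symmetric]) (use int in auto)
  also have "\<dots> = (\<integral>\<^sup>+i. \<integral>\<^sup>+x. ennreal (pmf p i) * indicator (A i) x \<partial>M \<partial>count_space ?I)"
    unfolding eq by (rule nn_integral_count_space_nn_integral) (use Am in auto)
  also have "\<dots> = (\<integral>\<^sup>+i. ennreal (pmf p i) * ennreal (prob (A i)) \<partial>count_space ?I)"
    using A by (intro nn_integral_cong) (simp add: nn_integral_cmult_indicator emeasure_eq_measure)
  also have "\<dots> = (\<integral>\<^sup>+i. ennreal (pmf p i) * ennreal (prob (A i)) * indicator ?I i \<partial>count_space UNIV)"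
    by (simp add: nn_integral_count_space_indicator)
  also have "\<dots> = (\<integral>\<^sup>+i. ennreal (pmf p i) * ennreal (prob (A i)) \<partial>count_space UNIV)"
    by (intro nn_integral_cong) (auto simp: indicator_def set_pmf_iff)
  also have "\<dots> = (\<integral>\<^sup>+i. ennreal (prob (A i)) \<partial>p)"
    by (rule nn_integral_measure_pmf[symmetric])
  also have "\<dots> = ennreal (measure_pmf.expectation p (\<lambda>i. prob (A i)))"
    by (rule nn_integral_eq_integral) (auto intro!: measure_pmf.integrable_const_bound[of _ 1])
  finally show "(\<integral>x. measure_pmf.prob p {i. x \<in> A i} \<partial>M) = measure_pmf.expectation p (\<lambda>i. prob (A i))"
    by (subst (asm) ennreal_inj) (auto intro!: integral_nonneg_AE)
qed

section \<open>Convolution powers\<close>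

context group
begin

lemma conv_power_carrier:
  assumes "set_pmf p \<subseteq> carrier G"
  shows "set_pmf (conv_power G p n) \<subseteq> carrier G"
proof (induction n)
  case (Suc n)
  then show ?case using assms by (fastforce intro: m_closed)
qed simp

lemma conv_power_add:
  assumes p: "set_pmf p \<subseteq> carrier G"
  shows "conv_power G p (i + j) =
    map_pmf (\<lambda>(\<phi>, \<psi>). \<phi> \<otimes> \<psi>) (pair_pmf (conv_power G p i) (conv_power G p j))"
proof (induction i)
  case 0
  have "map_pmf (\<lambda>\<psi>. \<one> \<otimes> \<psi>) (conv_power G p j) = map_pmf (\<lambda>\<psi>. \<psi>) (conv_power G p j)"
    using conv_power_carrier[OF p, of j] by (intro map_pmf_cong) auto
  then show ?case by (simp add: pair_return_pmf1 map_pmf_comp)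
next
  case (Suc i)
  let ?c = "conv_power G p"
  have "?c (Suc i + j) = do {a \<leftarrow> p; b \<leftarrow> ?c i; c \<leftarrow> ?c j; return_pmf (a \<otimes> (b \<otimes> c))}"
    by (simp add: Suc pair_pmf_def map_bind_pmf bind_map_pmf bind_assoc_pmf bind_return_pmf map_pmf_def)
  also have "\<dots> = do {a \<leftarrow> p; b \<leftarrow> ?c i; c \<leftarrow> ?c j; return_pmf (a \<otimes> b \<otimes> c)}"
    using p conv_power_carrier[OF p, of i] conv_power_carrier[OF p, of j]
    by (intro bind_pmf_cong refl) (auto simp: m_assoc subset_iff)
  also have "\<dots> = map_pmf (\<lambda>(\<phi>, \<psi>). \<phi> \<otimes> \<psi>) (pair_pmf (?c (Suc i)) (?c j))"
    by (simp add: pair_pmf_def map_bind_pmf bind_map_pmf bind_assoc_pmf bind_return_pmf map_pmf_def)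
  finally show ?case .
qed

lemma symmetric_map_inv:
  assumes p: "set_pmf p \<subseteq> carrier G" and sym: "symmetric_pmf G p"
  shows "map_pmf (\<lambda>x. inv x) p = p"
proof (rule pmf_eqI)
  fix x
  show "pmf (map_pmf (\<lambda>x. inv x) p) x = pmf p x"
  proof (cases "x \<in> carrier G")
    case True
    have "pmf (map_pmf (\<lambda>x. inv x) p) x = measure_pmf.prob p ((\<lambda>x. inv x) -` {x})"
      by (rule pmf_map)
    also have "\<dots> = measure_pmf.prob p {inv x}"
      by (rule measure_prob_cong_0) (use True p in \<open>auto simp: set_pmf_iff subset_iff\<close>)
    also have "\<dots> = pmf p x"
      using bspec[OF sym[unfolded symmetric_pmf_def] True] by (metis measure_pmf_single)
    finally show ?thesis .
  next
    case False
    then have "x \<notin> set_pmf (map_pmf (\<lambda>x. inv x) p)" "x \<notin> set_pmf p"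
      using p by (auto simp: subset_iff)
    then show ?thesis by (metis set_pmf_iff)
  qed
qed

lemma conv_power_map_inv:
  assumes p: "set_pmf p \<subseteq> carrier G" and sym: "symmetric_pmf G p"
  shows "map_pmf (\<lambda>x. inv x) (conv_power G p n) = conv_power G p n"
proof (induction n)
  case 0
  show ?case by simp
next
  case (Suc n)
  let ?c = "conv_power G p"
  have c1: "?c (Suc 0) = p"
  proof -
    have "map_pmf (\<lambda>\<psi>. \<psi> \<otimes> \<one>) p = map_pmf (\<lambda>\<psi>. \<psi>) p"
      using p by (intro map_pmf_cong) auto
    then show ?thesis by (simp add: pair_return_pmf2 map_pmf_comp)
  qed
  have "map_pmf (\<lambda>x. inv x) (?c (Suc n)) = do {a \<leftarrow> p; b \<leftarrow> ?c n; return_pmf (inv (a \<otimes> b))}"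
    by (simp add: pair_pmf_def map_bind_pmf bind_map_pmf bind_assoc_pmf bind_return_pmf map_pmf_def)
  also have "\<dots> = do {a \<leftarrow> p; b \<leftarrow> ?c n; return_pmf (inv b \<otimes> inv a)}"
    using p conv_power_carrier[OF p, of n]
    by (intro bind_pmf_cong refl) (auto simp: inv_mult_group subset_iff)
  also have "\<dots> = do {b \<leftarrow> ?c n; a \<leftarrow> p; return_pmf (inv b \<otimes> inv a)}"
    by (rule bind_commute_pmf)
  also have "\<dots> = do {b \<leftarrow> map_pmf (\<lambda>x. inv x) (?c n); a \<leftarrow> map_pmf (\<lambda>x. inv x) p; return_pmf (b \<otimes> a)}"
    by (simp add: bind_map_pmf)
  also have "\<dots> = map_pmf (\<lambda>(\<phi>, \<psi>). \<phi> \<otimes> \<psi>) (pair_pmf (?c n) (?c (Suc 0)))"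
    unfolding Suc symmetric_map_inv[OF p sym] c1
    by (simp add: pair_pmf_def map_bind_pmf bind_assoc_pmf bind_return_pmf map_pmf_def)
  also have "\<dots> = ?c (Suc n)"
    using conv_power_add[OF p, of n "Suc 0"] by simp
  finally show ?case .
qed

text \<open>Splitting the walk after the \<open>i\<close>-th factor and reversing the second part.\<close>

lemma conv_power_add_inv:
  assumes p: "set_pmf p \<subseteq> carrier G" and sym: "symmetric_pmf G p"
  shows "conv_power G p (i + j) =
    map_pmf (\<lambda>(\<phi>, \<psi>). \<phi> \<otimes> inv \<psi>) (pair_pmf (conv_power G p i) (conv_power G p j))"
proof -
  have "pair_pmf (conv_power G p i) (conv_power G p j) =
      map_pmf (\<lambda>(\<phi>, \<psi>). (\<phi>, inv \<psi>)) (pair_pmf (conv_power G p i) (conv_power G p j))"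
    using map_pair[of "\<lambda>x. x" "\<lambda>x. inv x" "conv_power G p i" "conv_power G p j"]
    by (simp add: conv_power_map_inv[OF p sym])
  from arg_cong[OF this, of "map_pmf (\<lambda>(\<phi>, \<psi>). \<phi> \<otimes> \<psi>)"] show ?thesis
    unfolding conv_power_add[OF p] map_pmf_comp by (simp add: case_prod_unfold)
qed

end

section \<open>Representatives in the full group\<close>

text \<open>The representative of a class of maps that also underlies \<open>return_prob\<close>.\<close>

definition rep :: "('a \<Rightarrow> 'a) set \<Rightarrow> 'a \<Rightarrow> 'a" where
  "rep \<phi> = (SOME f. f \<in> \<phi>)"

text \<open>A measure-preserving equivalence relation over a standard probability space.\<close>

locale pmp_relation =
  fixes M :: "'a measure" and R :: "('a \<times> 'a) set"
  assumes standard: "standard_prob_space M"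
    and eq_rel: "eq_rel_over M R"
    and measure_preserving: "measure_preserving_rel M R"
begin

sublocale prob_space M
  using standard by (simp add: standard_prob_space_def)

sublocale full: group "full_group M R"
  by (rule group_full_group[OF standard eq_rel measure_preserving])

abbreviation FG (\<open>\<Phi>\<close>) where "\<Phi> \<equiv> full_group M R"

lemma rep_class:
  assumes f: "f \<in> full_autos M R"
  shows "rep (ae_eq_rel M R `` {f}) \<in> full_autos M R"
    and "AE x in M. rep (ae_eq_rel M R `` {f}) x = f x"
proof -
  have "f \<in> ae_eq_rel M R `` {f}"
    using f by (simp add: ae_eq_rel_def)
  then have "rep (ae_eq_rel M R `` {f}) \<in> ae_eq_rel M R `` {f}"
    unfolding rep_def by (rule someI[where P = "\<lambda>g. g \<in> _"])
  then show "rep (ae_eq_rel M R `` {f}) \<in> full_autos M R"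
    and "AE x in M. rep (ae_eq_rel M R `` {f}) x = f x"
    by (auto simp: ae_eq_rel_def)
qed

lemma carrier_class:
  assumes "\<phi> \<in> carrier \<Phi>"
  shows "rep \<phi> \<in> full_autos M R" and "ae_eq_rel M R `` {rep \<phi>} = \<phi>"
proof -
  note equiv = ae_eq_equiv[OF standard eq_rel measure_preserving]
  obtain f where f: "f \<in> full_autos M R" "\<phi> = ae_eq_rel M R `` {f}"
    using assms by (auto simp: full_group_def elim: quotientE)
  show "rep \<phi> \<in> full_autos M R" using rep_class(1)[OF f(1)] f(2) by simp
  then have "(f, rep \<phi>) \<in> ae_eq_rel M R"
    using rep_class(2)[OF f(1)] f by (auto simp: ae_eq_rel_def)
  then show "ae_eq_rel M R `` {rep \<phi>} = \<phi>"
    using equiv_class_eq[OF equiv, of f "rep \<phi>"] f(2) by metis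
qed

lemma rep_measurable: "\<phi> \<in> carrier \<Phi> \<Longrightarrow> rep \<phi> \<in> measurable M M"
  using carrier_class(1) by (simp add: full_autos_def)

lemma rep_space: "\<phi> \<in> carrier \<Phi> \<Longrightarrow> x \<in> space M \<Longrightarrow> rep \<phi> x \<in> space M"
  using rep_measurable measurable_space by metis

lemma rep_inj: "\<phi> \<in> carrier \<Phi> \<Longrightarrow> inj_on (rep \<phi>) (space M)"
  using carrier_class(1) by (auto simp: full_autos_def bij_betw_def)

lemma AE_rep: "\<phi> \<in> carrier \<Phi> \<Longrightarrow> AE x in M. P x \<Longrightarrow> AE x in M. P (rep \<phi> x)"
  using full_autos_AE[OF standard eq_rel measure_preserving carrier_class(1)] .

lemma rep_one: "AE x in M. rep \<one>\<^bsub>\<Phi>\<^esub> x = x"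
  using rep_class(2)[OF full_autos_id[OF standard eq_rel measure_preserving]]
  by (simp add: full_group_def)

lemma rep_mult:
  assumes "\<phi> \<in> carrier \<Phi>" "\<psi> \<in> carrier \<Phi>"
  shows "AE x in M. rep (\<phi> \<otimes>\<^bsub>\<Phi>\<^esub> \<psi>) x = rep \<phi> (rep \<psi> x)"
proof -
  note reps = carrier_class(1)[OF assms(1)] carrier_class(1)[OF assms(2)]
  have "\<phi> \<otimes>\<^bsub>\<Phi>\<^esub> \<psi> = ae_eq_rel M R `` {rep \<phi> \<circ> rep \<psi>}"
    using full_group_mult[OF standard eq_rel measure_preserving reps] carrier_class(2) assms by simp
  then show ?thesis
    using rep_class(2)[OF full_autos_comp[OF standard eq_rel measure_preserving reps]] by simp
qed

lemma prob_preimage_rep: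
  assumes \<phi>: "\<phi> \<in> carrier \<Phi>" and A[measurable]: "A \<in> events"
  shows "prob {x \<in> space M. rep \<phi> x \<in> A} = prob A"
proof -
  let ?f = "rep \<phi>" and ?g = "the_inv_into (space M) (rep \<phi>)"
  note f = carrier_class(1)[OF \<phi>]
  note g = full_autos_inv[OF standard eq_rel measure_preserving f]
  have [measurable]: "?f \<in> measurable M M" "?g \<in> measurable M M" "R \<in> sets (M \<Otimes>\<^sub>M M)"
    and fR: "AE x in M. ?f x \<in> R `` {x}" and gR: "AE x in M. ?g x \<in> R `` {x}"
    using f g eq_rel by (auto simp: full_autos_def eq_rel_over_def)
  have "prob {x \<in> space M. ?f x \<in> A} = prob {x \<in> space M. ?f x \<in> A \<and> ?f x \<in> R `` {x}}"
    by (rule finite_measure_eq_AE) (use fR in auto)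
  also have "\<dots> = prob {y \<in> space M. y \<in> A \<and> ?g y \<in> R `` {y}}"
    using full_autos_push[OF standard eq_rel measure_preserving f A] by (simp add: measure_def)
  also have "\<dots> = prob A"
    by (rule finite_measure_eq_AE) (use gR sets.sets_into_space[OF A] in auto)
  finally show ?thesis .
qed

section \<open>Average return probabilities\<close>

text \<open>The set of points that \<open>\<phi>\<close> leaves in their \<open>E\<close>-class.\<close>

definition stay :: "('a \<times> 'a) set \<Rightarrow> ('a \<Rightarrow> 'a) set \<Rightarrow> 'a set" where
  "stay E \<phi> = {x \<in> space M. (x, rep \<phi> x) \<in> E}"

text \<open>The average of \<open>return_prob\<close> over the starting point, for an arbitrary distribution \<open>p\<close> on the
  full group; see \<open>integral_return_prob\<close>.\<close>

definition avg :: "('a \<times> 'a) set \<Rightarrow> ('a \<Rightarrow> 'a) set pmf \<Rightarrow> real" where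
  "avg E p = measure_pmf.expectation p (\<lambda>\<phi>. prob (stay E \<phi>))"

text \<open>The average probability that independent \<open>\<alpha>\<close> and \<open>\<beta>\<close>, distributed according to \<open>p\<close> and \<open>q\<close>,
  move a point into the same \<open>E\<close>-class. It is defined by means of \<open>\<alpha> \<beta>\<^sup>-\<^sup>1\<close>, which moves \<open>\<beta> x\<close> to
  \<open>\<alpha> x\<close>; \<open>corr_eq_integral\<close> gives the description in terms of classes.\<close>

definition corr :: "('a \<times> 'a) set \<Rightarrow> ('a \<Rightarrow> 'a) set pmf \<Rightarrow> ('a \<Rightarrow> 'a) set pmf \<Rightarrow> real" where
  "corr E p q = avg E (map_pmf (\<lambda>(\<alpha>, \<beta>). \<alpha> \<otimes>\<^bsub>\<Phi>\<^esub> inv\<^bsub>\<Phi>\<^esub> \<beta>) (pair_pmf p q))"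

lemma coincide_events:
  assumes "E \<in> sets (M \<Otimes>\<^sub>M M)" "\<phi> \<in> carrier \<Phi>" "\<psi> \<in> carrier \<Phi>"
  shows "{x \<in> space M. (rep \<phi> x, rep \<psi> x) \<in> E} \<in> events"
proof -
  have [measurable]: "E \<in> sets (M \<Otimes>\<^sub>M M)" "rep \<phi> \<in> measurable M M" "rep \<psi> \<in> measurable M M"
    using assms rep_measurable by auto
  show ?thesis by measurable
qed

lemma stay_events:
  assumes "E \<in> sets (M \<Otimes>\<^sub>M M)" "\<phi> \<in> carrier \<Phi>"
  shows "stay E \<phi> \<in> events"
proof -
  have [measurable]: "E \<in> sets (M \<Otimes>\<^sub>M M)" "rep \<phi> \<in> measurable M M"
    using assms rep_measurable by auto
  show ?thesis unfolding stay_def by measurable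
qed

text \<open>The substitution \<open>x \<mapsto> \<beta> x\<close>, which preserves the measure.\<close>

lemma prob_stay_mult_inv:
  assumes E: "E \<in> sets (M \<Otimes>\<^sub>M M)" and \<alpha>: "\<alpha> \<in> carrier \<Phi>" and \<beta>: "\<beta> \<in> carrier \<Phi>"
  shows "prob (stay E (\<alpha> \<otimes>\<^bsub>\<Phi>\<^esub> inv\<^bsub>\<Phi>\<^esub> \<beta>)) = prob {x \<in> space M. (rep \<beta> x, rep \<alpha> x) \<in> E}"
proof -
  let ?\<gamma> = "\<alpha> \<otimes>\<^bsub>\<Phi>\<^esub> inv\<^bsub>\<Phi>\<^esub> \<beta>"
  have \<gamma>: "?\<gamma> \<in> carrier \<Phi>" "?\<gamma> \<otimes>\<^bsub>\<Phi>\<^esub> \<beta> = \<alpha>" using \<alpha> \<beta> by (simp_all add: full.m_assoc)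
  have [measurable]: "E \<in> sets (M \<Otimes>\<^sub>M M)" "rep \<alpha> \<in> measurable M M" "rep \<beta> \<in> measurable M M"
      "rep ?\<gamma> \<in> measurable M M" "stay E ?\<gamma> \<in> events"
    using E \<alpha> \<beta> \<gamma> rep_measurable stay_events by auto
  have "prob (stay E ?\<gamma>) = prob {x \<in> space M. rep \<beta> x \<in> stay E ?\<gamma>}"
    by (rule prob_preimage_rep[symmetric]) (use \<beta> in auto)
  also have "\<dots> = prob {x \<in> space M. (rep \<beta> x, rep \<alpha> x) \<in> E}"
  proof (rule finite_measure_eq_AE)
    have "AE x in M. rep \<alpha> x = rep ?\<gamma> (rep \<beta> x)"
      using rep_mult[OF \<gamma>(1) \<beta>] unfolding \<gamma>(2) .
    then show "AE x in M. x \<in> {x \<in> space M. rep \<beta> x \<in> stay E ?\<gamma>} \<longleftrightarrow>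
        x \<in> {x \<in> space M. (rep \<beta> x, rep \<alpha> x) \<in> E}"
      by eventually_elim (use rep_space[OF \<beta>] in \<open>auto simp: stay_def\<close>)
  qed measurable
  finally show ?thesis .
qed

lemma avg_nonneg: "0 \<le> avg E p"
  by (simp add: avg_def integral_nonneg_AE)

lemma avg_le_1: "avg E p \<le> 1"
proof -
  have "avg E p \<le> measure_pmf.expectation p (\<lambda>_. 1)"
    unfolding avg_def by (intro integral_mono measure_pmf.integrable_const_bound[of _ 1]) auto
  then show ?thesis by simp
qed

lemma integrable_prob: "integrable (measure_pmf p) (\<lambda>i. prob (A i))"
  by (intro measure_pmf.integrable_const_bound[of _ 1]) auto

lemma avg_mono: "E \<subseteq> F \<Longrightarrow> F \<in> sets (M \<Otimes>\<^sub>M M) \<Longrightarrow> set_pmf p \<subseteq> carrier \<Phi> \<Longrightarrow> avg E p \<le> avg F p"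
  unfolding avg_def
  by (intro integral_mono_AE integrable_prob)
    (auto simp: AE_measure_pmf_iff stay_def intro!: finite_measure_mono stay_events[unfolded stay_def])

lemma avg_map: "avg E (map_pmf f p) = measure_pmf.expectation p (\<lambda>i. prob (stay E (f i)))"
  by (simp add: avg_def)

lemma integral_return_prob:
  assumes E: "E \<in> sets (M \<Otimes>\<^sub>M M)" and \<nu>: "set_pmf \<nu> \<subseteq> carrier \<Phi>"
  shows "(\<integral>x. return_prob M R E \<nu> n x \<partial>M) = avg E (conv_power \<Phi> \<nu> n)"
proof -
  have "(\<integral>x. return_prob M R E \<nu> n x \<partial>M) = (\<integral>x. measure_pmf.prob (conv_power \<Phi> \<nu> n) {\<phi>. x \<in> stay E \<phi>} \<partial>M)"
    by (intro Bochner_Integration.integral_cong) (auto simp: return_prob_def stay_def rep_def)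
  also have "\<dots> = avg E (conv_power \<Phi> \<nu> n)"
    unfolding avg_def
    by (rule integral_pmf_prob) (use stay_events[OF E] full.conv_power_carrier[OF \<nu>] in auto)
  finally show ?thesis .
qed

lemma
  assumes E: "eq_rel_over M E" and p: "set_pmf p \<subseteq> carrier \<Phi>" and q: "set_pmf q \<subseteq> carrier \<Phi>"
  defines "c \<equiv> \<lambda>x. measure_pmf.prob (pair_pmf p q) {(\<alpha>, \<beta>). E `` {rep \<alpha> x} = E `` {rep \<beta> x}}"
  shows corr_integrable: "integrable M c" and corr_eq_integral: "corr E p q = (\<integral>x. c x \<partial>M)"
proof -
  have Em: "E \<in> sets (M \<Otimes>\<^sub>M M)" and equiv: "equiv (space M) E"
    using E by (auto simp: eq_rel_over_def)
  define A where "A z = {x \<in> space M. (rep (snd z) x, rep (fst z) x) \<in> E}" for z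
  have A: "A z \<in> events" if "z \<in> set_pmf (pair_pmf p q)" for z
    unfolding A_def using that p q by (intro coincide_events[OF Em]) auto
  have c: "c x = measure_pmf.prob (pair_pmf p q) {z. x \<in> A z}" if x: "x \<in> space M" for x
    unfolding c_def
  proof (rule measure_prob_cong_0)
    have eq: "E `` {rep \<alpha> x} = E `` {rep \<beta> x} \<longleftrightarrow> x \<in> A (\<alpha>, \<beta>)" if "pmf (pair_pmf p q) (\<alpha>, \<beta>) \<noteq> 0" for \<alpha> \<beta>
    proof -
      have "\<alpha> \<in> carrier \<Phi>" "\<beta> \<in> carrier \<Phi>" using that p q by (auto simp: pmf_pair set_pmf_iff subset_iff)
      then have "E `` {rep \<beta> x} = E `` {rep \<alpha> x} \<longleftrightarrow> (rep \<beta> x, rep \<alpha> x) \<in> E"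
        using eq_equiv_class_iff[OF equiv] rep_space x by blast
      then show ?thesis using x by (auto simp: A_def)
    qed
    then show "pmf (pair_pmf p q) z = 0"
      if "z \<in> {(\<alpha>, \<beta>). E `` {rep \<alpha> x} = E `` {rep \<beta> x}} - {z. x \<in> A z}" for z
      using that by auto
    show "pmf (pair_pmf p q) z = 0"
      if "z \<in> {z. x \<in> A z} - {(\<alpha>, \<beta>). E `` {rep \<alpha> x} = E `` {rep \<beta> x}}" for z
      using that eq by auto
  qed
  show "integrable M c"
    using integrable_pmf_prob[of "pair_pmf p q" A, OF A] c
    by (simp cong: Bochner_Integration.integrable_cong)
  have "corr E p q = measure_pmf.expectation (pair_pmf p q) (\<lambda>z. prob (A z))"
    unfolding corr_def avg_map
    by (intro integral_cong_AE)
      (use p q in \<open>auto simp: AE_measure_pmf_iff A_def prob_stay_mult_inv[OF Em] subset_iff\<close>)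
  also have "\<dots> = (\<integral>x. measure_pmf.prob (pair_pmf p q) {z. x \<in> A z} \<partial>M)"
    by (rule integral_pmf_prob[symmetric]) (rule A)
  also have "\<dots> = (\<integral>x. c x \<partial>M)"
    by (intro Bochner_Integration.integral_cong) (simp_all add: c)
  finally show "corr E p q = (\<integral>x. c x \<partial>M)" .
qed

lemma corr_nonneg: "0 \<le> corr E p q"
  by (simp add: corr_def avg_nonneg)

lemma corr_cauchy_schwarz:
  assumes E: "eq_rel_over M E" and p: "set_pmf p \<subseteq> carrier \<Phi>" and q: "set_pmf q \<subseteq> carrier \<Phi>"
  shows "(corr E p q)\<^sup>2 \<le> corr E p p * corr E q q"
proof (rule amgm_family_imp_cauchy_schwarz)
  fix u v :: real
  assume uv: "0 \<le> u" "0 \<le> v"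
  define c where "c p q x = measure_pmf.prob (pair_pmf p q) {(\<alpha>, \<beta>). E `` {rep \<alpha> x} = E `` {rep \<beta> x}}" for p q x
  note [simp] = corr_integrable[OF E, folded c_def]
  note eq = corr_eq_integral[OF E, folded c_def]
  have "2 * u * v * corr E p q = (\<integral>x. 2 * u * v * c p q x \<partial>M)"
    using p q by (simp add: eq)
  also have "\<dots> \<le> (\<integral>x. u\<^sup>2 * c p p x + v\<^sup>2 * c q q x \<partial>M)"
  proof (rule integral_mono)
    fix x
    show "2 * u * v * c p q x \<le> u\<^sup>2 * c p p x + v\<^sup>2 * c q q x"
      unfolding c_def by (rule prob_coincidence_amgm[OF uv])
  qed (use p q in auto)
  also have "\<dots> = u\<^sup>2 * corr E p p + v\<^sup>2 * corr E q q"
    using p q by (simp add: eq)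
  finally show "2 * u * v * corr E p q \<le> u\<^sup>2 * corr E p p + v\<^sup>2 * corr E q q" .
qed (rule corr_nonneg)+

lemma diagonal_eq_rel: "eq_rel_over M (Id_on (space M))"
proof -
  have "Id_on (space M) = {(x, y). x \<in> space M \<and> x = y}" by auto
  then have "Id_on (space M) \<in> sets (M \<Otimes>\<^sub>M M)"
    using standard_borel_diagonal[of M] standard by (simp add: standard_prob_space_def)
  then show ?thesis by (auto simp: eq_rel_over_def equiv_def refl_on_def sym_def trans_def)
qed

lemma diagonal_sets: "Id_on (space M) \<in> sets (M \<Otimes>\<^sub>M M)"
  using diagonal_eq_rel by (simp add: eq_rel_over_def)

text \<open>Left translation by \<open>g\<close> does not change whether \<open>\<alpha> x = \<beta> x\<close>, because \<open>g\<close> is injective. This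
  step is special to the diagonal: \<open>g\<close> need not preserve the classes of other relations.\<close>

lemma corr_diagonal_translate:
  assumes p: "set_pmf p \<subseteq> carrier \<Phi>" and g: "g \<in> carrier \<Phi>"
  defines "q \<equiv> map_pmf (\<lambda>\<beta>. g \<otimes>\<^bsub>\<Phi>\<^esub> \<beta>) p"
  shows "corr (Id_on (space M)) q q = corr (Id_on (space M)) p p"
proof -
  let ?D = "Id_on (space M)"
  have eq: "prob (stay ?D ((g \<otimes>\<^bsub>\<Phi>\<^esub> \<alpha>) \<otimes>\<^bsub>\<Phi>\<^esub> inv\<^bsub>\<Phi>\<^esub> (g \<otimes>\<^bsub>\<Phi>\<^esub> \<beta>))) = prob (stay ?D (\<alpha> \<otimes>\<^bsub>\<Phi>\<^esub> inv\<^bsub>\<Phi>\<^esub> \<beta>))"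
    if "\<alpha> \<in> carrier \<Phi>" "\<beta> \<in> carrier \<Phi>" for \<alpha> \<beta>
  proof -
    have "prob {x \<in> space M. (rep (g \<otimes>\<^bsub>\<Phi>\<^esub> \<beta>) x, rep (g \<otimes>\<^bsub>\<Phi>\<^esub> \<alpha>) x) \<in> ?D} =
      prob {x \<in> space M. (rep \<beta> x, rep \<alpha> x) \<in> ?D}"
    proof (rule finite_measure_eq_AE)
      show "AE x in M. x \<in> {x \<in> space M. (rep (g \<otimes>\<^bsub>\<Phi>\<^esub> \<beta>) x, rep (g \<otimes>\<^bsub>\<Phi>\<^esub> \<alpha>) x) \<in> ?D} \<longleftrightarrow>
        x \<in> {x \<in> space M. (rep \<beta> x, rep \<alpha> x) \<in> ?D}"
        using rep_mult[OF g that(1)] rep_mult[OF g that(2)]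
      proof eventually_elim
        case (elim x)
        have "rep g (rep \<beta> x) = rep g (rep \<alpha> x) \<longleftrightarrow> rep \<beta> x = rep \<alpha> x" if "x \<in> space M"
          using rep_inj[OF g] rep_space \<open>\<alpha> \<in> carrier \<Phi>\<close> \<open>\<beta> \<in> carrier \<Phi>\<close> that by (auto dest: inj_onD)
        then show ?case using elim rep_space g that by (auto simp: Id_on_iff)
      qed
    qed (use that g coincide_events[OF diagonal_sets] in auto)
    then show ?thesis using that g by (simp add: prob_stay_mult_inv[OF diagonal_sets])
  qed
  have "pair_pmf q q = map_pmf (\<lambda>(\<alpha>, \<beta>). (g \<otimes>\<^bsub>\<Phi>\<^esub> \<alpha>, g \<otimes>\<^bsub>\<Phi>\<^esub> \<beta>)) (pair_pmf p p)"
    by (simp add: q_def map_pair)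
  then have "corr ?D q q = measure_pmf.expectation (pair_pmf p p)
     (\<lambda>(\<alpha>, \<beta>). prob (stay ?D ((g \<otimes>\<^bsub>\<Phi>\<^esub> \<alpha>) \<otimes>\<^bsub>\<Phi>\<^esub> inv\<^bsub>\<Phi>\<^esub> (g \<otimes>\<^bsub>\<Phi>\<^esub> \<beta>))))"
    by (simp add: corr_def avg_map case_prod_unfold)
  also have "\<dots> = corr ?D p p"
    unfolding corr_def avg_map
    by (intro integral_cong_AE) (use p eq in \<open>auto simp: AE_measure_pmf_iff subset_iff\<close>)
  finally show ?thesis .
qed

end

section \<open>The random walk\<close>

text \<open>A measure-preserving relation with a symmetric step distribution on its full group.\<close>

locale pmp_random_walk = pmp_relation M R
  for M :: "'a measure" and R :: "('a \<times> 'a) set" +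
  fixes \<nu> :: "('a \<Rightarrow> 'a) set pmf"
  assumes support: "set_pmf \<nu> \<subseteq> carrier \<Phi>"
    and symmetric: "symmetric_pmf \<Phi> \<nu>"
begin

abbreviation walk :: "nat \<Rightarrow> ('a \<Rightarrow> 'a) set pmf" where
  "walk n \<equiv> conv_power \<Phi> \<nu> n"

text \<open>The average probability of return to the \<open>E\<close>-class after \<open>2n\<close> steps.\<close>

definition ret :: "('a \<times> 'a) set \<Rightarrow> nat \<Rightarrow> real" where
  "ret E n = avg E (walk (2 * n))"

lemma walk_carrier: "set_pmf (walk n) \<subseteq> carrier \<Phi>"
  by (rule full.conv_power_carrier[OF support])

lemma avg_walk_add: "avg E (walk (i + j)) = corr E (walk i) (walk j)"
  unfolding corr_def full.conv_power_add_inv[OF support symmetric] ..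

lemma ret_0:
  assumes E: "eq_rel_over M E"
  shows "ret E 0 = 1"
proof -
  have "AE x in M. x \<in> stay E \<one>\<^bsub>\<Phi>\<^esub>"
    using rep_one AE_space
    by eventually_elim (use E in \<open>auto simp: stay_def eq_rel_over_def equiv_def refl_on_def\<close>)
  then have "prob (stay E \<one>\<^bsub>\<Phi>\<^esub>) = 1"
    using E by (subst prob_eq_1) (auto simp: eq_rel_over_def intro: stay_events)
  then show ?thesis by (simp add: ret_def avg_def)
qed

lemma ret_log_convex:
  assumes E: "eq_rel_over M E"
  shows "(ret E (Suc n))\<^sup>2 \<le> ret E n * ret E (Suc (Suc n))"
  using corr_cauchy_schwarz[OF E walk_carrier walk_carrier, of n "Suc (Suc n)"]
    avg_walk_add[of E n "Suc (Suc n)"] avg_walk_add[of E n n] avg_walk_add[of E "Suc (Suc n)" "Suc (Suc n)"]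
  by (simp add: ret_def mult_2 del: conv_power.simps)

lemma ret_nonneg: "0 \<le> ret E n" and ret_le_1: "ret E n \<le> 1"
  by (simp_all add: ret_def avg_nonneg avg_le_1)

text \<open>The probability that the walk of length \<open>2n\<close> agrees with a fixed \<open>g\<close> is at most its return
  probability: cut the walk in the middle, move \<open>g\<close> to the second half, and apply Cauchy-Schwarz.\<close>

lemma ret_diagonal_translate:
  assumes g: "g \<in> carrier \<Phi>"
  shows "avg (Id_on (space M)) (map_pmf (\<lambda>\<phi>. \<phi> \<otimes>\<^bsub>\<Phi>\<^esub> inv\<^bsub>\<Phi>\<^esub> g) (walk (2 * n))) \<le> ret (Id_on (space M)) n"
proof -
  let ?D = "Id_on (space M)" and ?p = "walk n"
  let ?q = "map_pmf (\<lambda>\<beta>. g \<otimes>\<^bsub>\<Phi>\<^esub> \<beta>) ?p"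
  have q: "set_pmf ?q \<subseteq> carrier \<Phi>" using walk_carrier[of n] g by auto
  have pp: "corr ?D ?p ?p = ret ?D n"
    using avg_walk_add[of ?D n n] by (simp add: ret_def mult_2)
  have "pair_pmf ?p ?q = map_pmf (\<lambda>(\<alpha>, \<beta>). (\<alpha>, g \<otimes>\<^bsub>\<Phi>\<^esub> \<beta>)) (pair_pmf ?p ?p)"
    using map_pair[of "\<lambda>\<alpha>. \<alpha>" "\<lambda>\<beta>. g \<otimes>\<^bsub>\<Phi>\<^esub> \<beta>" ?p ?p] by simp
  then have "map_pmf (\<lambda>(\<alpha>, \<beta>). \<alpha> \<otimes>\<^bsub>\<Phi>\<^esub> inv\<^bsub>\<Phi>\<^esub> \<beta>) (pair_pmf ?p ?q) =
      map_pmf (\<lambda>(\<alpha>, \<beta>). \<alpha> \<otimes>\<^bsub>\<Phi>\<^esub> inv\<^bsub>\<Phi>\<^esub> (g \<otimes>\<^bsub>\<Phi>\<^esub> \<beta>)) (pair_pmf ?p ?p)"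
    by (simp add: map_pmf_comp case_prod_unfold)
  also have "\<dots> = map_pmf (\<lambda>(\<alpha>, \<beta>). (\<alpha> \<otimes>\<^bsub>\<Phi>\<^esub> inv\<^bsub>\<Phi>\<^esub> \<beta>) \<otimes>\<^bsub>\<Phi>\<^esub> inv\<^bsub>\<Phi>\<^esub> g) (pair_pmf ?p ?p)"
    using walk_carrier[of n] g
    by (intro map_pmf_cong) (auto simp: subset_iff full.inv_mult_group full.m_assoc)
  also have "\<dots> = map_pmf (\<lambda>\<phi>. \<phi> \<otimes>\<^bsub>\<Phi>\<^esub> inv\<^bsub>\<Phi>\<^esub> g) (walk (n + n))"
    unfolding full.conv_power_add_inv[OF support symmetric] by (simp add: map_pmf_comp case_prod_unfold)
  finally have pq: "corr ?D ?p ?q = avg ?D (map_pmf (\<lambda>\<phi>. \<phi> \<otimes>\<^bsub>\<Phi>\<^esub> inv\<^bsub>\<Phi>\<^esub> g) (walk (2 * n)))"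
    by (simp add: corr_def mult_2)
  have "(corr ?D ?p ?q)\<^sup>2 \<le> (ret ?D n)\<^sup>2"
    using corr_cauchy_schwarz[OF diagonal_eq_rel walk_carrier q, of n]
      corr_diagonal_translate[OF walk_carrier g, of n]
    by (simp add: pp power2_eq_square)
  then show ?thesis
    unfolding pq using ret_nonneg by (rule power2_le_imp_le)
qed

section \<open>Truncating a relation with finite classes\<close>

text \<open>All group elements that the walk can reach, enumerated (possibly with repetitions) by \<open>gen\<close>.\<close>

definition orb :: "('a \<Rightarrow> 'a) set set" where
  "orb = (\<Union>n. set_pmf (walk n))"

abbreviation gen :: "nat \<Rightarrow> ('a \<Rightarrow> 'a) set" where
  "gen \<equiv> from_nat_into orb"

lemma orb_carrier: "orb \<subseteq> carrier \<Phi>"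
  unfolding orb_def using walk_carrier by blast

lemma orb_countable: "countable orb"
  unfolding orb_def by simp

lemma orb_nonempty: "orb \<noteq> {}"
  by (simp add: orb_def set_pmf_not_empty)

lemma gen_carrier: "gen i \<in> carrier \<Phi>"
  by (rule subsetD[OF orb_carrier from_nat_into[OF orb_nonempty]])

text \<open>The points whose \<open>E\<close>-class contains no other points reachable by the walk than their images
  under the first \<open>m\<close> elements of the enumeration. Quantifying over the countable set \<open>orb\<close>,
  instead of bounding the cardinality of the class, makes measurability immediate.\<close>

definition core :: "('a \<times> 'a) set \<Rightarrow> nat \<Rightarrow> 'a set" where
  "core E m = {x \<in> space M. \<forall>\<phi>\<in>orb. (x, rep \<phi> x) \<in> E \<longrightarrow> (\<exists>i<m. rep \<phi> x = rep (gen i) x)}"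

text \<open>The relation \<open>E\<close> restricted to \<open>core E m\<close>; the points outside are only related to
  themselves. The core
  need not be a union of \<open>E\<close>-classes.\<close>

definition trunc :: "('a \<times> 'a) set \<Rightarrow> nat \<Rightarrow> ('a \<times> 'a) set" where
  "trunc E m = Id_on (space M) \<union> E \<inter> core E m \<times> core E m"

lemma core_events:
  assumes E: "E \<in> sets (M \<Otimes>\<^sub>M M)"
  shows "core E m \<in> events"
proof -
  let ?D = "Id_on (space M)"
  let ?C = "\<lambda>\<phi> i. {x \<in> space M. (rep \<phi> x, rep (gen i) x) \<in> ?D}"
  have "core E m = (\<Inter>\<phi>\<in>orb. (space M - stay E \<phi>) \<union> (\<Union>i<m. ?C \<phi> i))"
    using orb_nonempty rep_space gen_carrier orb_carrier
    by (auto simp: core_def stay_def Id_on_iff subset_iff) (metis lessThan_iff)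
  moreover have "(space M - stay E \<phi>) \<union> (\<Union>i<m. ?C \<phi> i) \<in> events" if "\<phi> \<in> orb" for \<phi>
    using that orb_carrier gen_carrier
    by (intro sets.Un sets.compl_sets stay_events[OF E] sets.finite_UN coincide_events[OF diagonal_sets]) auto
  ultimately show ?thesis
    using orb_countable orb_nonempty by (auto intro!: sets.countable_INT')
qed

lemma trunc_eq_rel:
  assumes E: "eq_rel_over M E"
  shows "eq_rel_over M (trunc E m)"
proof -
  have Em: "E \<in> sets (M \<Otimes>\<^sub>M M)" and equiv: "equiv (space M) E"
    using E by (auto simp: eq_rel_over_def)
  have "trunc E m \<in> sets (M \<Otimes>\<^sub>M M)"
    unfolding trunc_def using diagonal_sets Em core_events[OF Em] by auto
  moreover have "equiv (space M) (trunc E m)"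
  proof (rule equivI)
    show "trunc E m \<subseteq> space M \<times> space M" by (auto simp: trunc_def core_def)
    show "refl_on (space M) (trunc E m)" by (auto simp: trunc_def refl_on_def core_def)
    show "sym (trunc E m)" using equiv by (auto simp: trunc_def sym_def equiv_def)
    show "trans (trunc E m)" using equiv by (auto simp: trunc_def trans_def equiv_def)
  qed
  ultimately show ?thesis by (simp add: eq_rel_over_def)
qed

lemma core_mono: "k \<le> l \<Longrightarrow> core E k \<subseteq> core E l"
  unfolding core_def using order_less_le_trans by blast

lemma trunc_incseq: "incseq (trunc E)"
proof (rule incseq_SucI)
  fix m
  show "trunc E m \<le> trunc E (Suc m)"
    using core_mono[of m "Suc m" E] by (auto simp: trunc_def)
qed

lemma ret_trunc_le:
  assumes E: "E \<in> sets (M \<Otimes>\<^sub>M M)"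
  shows "ret (trunc E m) n \<le> real (Suc m) * ret (Id_on (space M)) n"
proof -
  let ?D = "Id_on (space M)" and ?p = "walk (2 * n)"
  let ?t = "\<lambda>i \<phi>. \<phi> \<otimes>\<^bsub>\<Phi>\<^esub> inv\<^bsub>\<Phi>\<^esub> gen i"
  have pt: "prob (stay (trunc E m) \<phi>) \<le> prob (stay ?D \<phi>) + (\<Sum>i<m. prob (stay ?D (?t i \<phi>)))"
    if "\<phi> \<in> set_pmf ?p" for \<phi>
  proof -
    let ?C = "\<lambda>i. {x \<in> space M. (rep (gen i) x, rep \<phi> x) \<in> ?D}"
    have orb: "\<phi> \<in> orb" using that unfolding orb_def by blast
    then have \<phi>: "\<phi> \<in> carrier \<Phi>" using orb_carrier by blast
    have "stay (trunc E m) \<phi> \<subseteq> stay ?D \<phi> \<union> (\<Union>i<m. ?C i)"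
    proof
      fix x assume "x \<in> stay (trunc E m) \<phi>"
      then have x: "x \<in> space M" "(x, rep \<phi> x) \<in> ?D \<or> (x, rep \<phi> x) \<in> E \<and> x \<in> core E m"
        by (auto simp: stay_def trunc_def)
      show "x \<in> stay ?D \<phi> \<union> (\<Union>i<m. ?C i)"
      proof (cases "(x, rep \<phi> x) \<in> ?D")
        case True
        then show ?thesis using x by (simp add: stay_def)
      next
        case False
        then obtain i where "i < m" "rep \<phi> x = rep (gen i) x"
          using x orb unfolding core_def by blast
        then show ?thesis using x rep_space[OF gen_carrier] by (auto simp: Id_on_iff)
      qed
    qed
    moreover have C: "?C i \<in> events" for i
      using coincide_events[OF diagonal_sets gen_carrier \<phi>] .
    ultimately have "prob (stay (trunc E m) \<phi>) \<le> prob (stay ?D \<phi> \<union> (\<Union>i<m. ?C i))"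
      using stay_events[OF diagonal_sets \<phi>] by (intro finite_measure_mono) auto
    also have "\<dots> \<le> prob (stay ?D \<phi>) + prob (\<Union>i<m. ?C i)"
      using stay_events[OF diagonal_sets \<phi>] C by (intro measure_Un_le) auto
    also have "prob (\<Union>i<m. ?C i) \<le> (\<Sum>i<m. prob (?C i))"
      using C by (intro finite_measure_subadditive_finite) auto
    finally show ?thesis
      by (simp add: prob_stay_mult_inv[OF diagonal_sets \<phi> gen_carrier])
  qed
  have "ret (trunc E m) n \<le> measure_pmf.expectation ?p (\<lambda>\<phi>. prob (stay ?D \<phi>) + (\<Sum>i<m. prob (stay ?D (?t i \<phi>))))"
    unfolding ret_def avg_def using pt
    by (intro integral_mono_AE Bochner_Integration.integrable_add Bochner_Integration.integrable_sum integrable_prob)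
      (simp add: AE_measure_pmf_iff)
  also have "\<dots> = ret ?D n + (\<Sum>i<m. avg ?D (map_pmf (?t i) ?p))"
    by (simp add: ret_def avg_map integrable_prob Bochner_Integration.integral_sum, simp add: avg_def)
  also have "\<dots> \<le> ret ?D n + (\<Sum>i<m. ret ?D n)"
    by (intro add_left_mono sum_mono ret_diagonal_translate gen_carrier)
  finally show ?thesis by (simp add: algebra_simps)
qed

section \<open>Exhaustions\<close>

text \<open>Only the points \<open>\<phi> x\<close> with \<open>\<phi>\<close> reachable by the walk matter, so the exhaustion is required
  only there.\<close>

lemma ret_exhaustion_le:
  assumes F: "\<And>k. F k \<in> sets (M \<Otimes>\<^sub>M M)" "incseq F" and E: "E \<in> sets (M \<Otimes>\<^sub>M M)"
    and exhaust: "\<And>\<phi>. \<phi> \<in> orb \<Longrightarrow> AE x in M. (x, rep \<phi> x) \<in> E \<longleftrightarrow> (\<exists>k. (x, rep \<phi> x) \<in> F k)"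
    and le: "\<And>k. ret (F k) n \<le> c"
  shows "ret E n \<le> c"
proof -
  let ?p = "walk (2 * n)"
  have "(\<lambda>k. prob (stay (F k) \<phi>)) \<longlonglongrightarrow> prob (stay E \<phi>)" if "\<phi> \<in> set_pmf ?p" for \<phi>
  proof -
    have orb: "\<phi> \<in> orb" using that unfolding orb_def by blast
    then have \<phi>: "\<phi> \<in> carrier \<Phi>" using orb_carrier by blast
    have events: "range (\<lambda>k. stay (F k) \<phi>) \<subseteq> events" using stay_events[OF F(1) \<phi>] by auto
    have "(\<lambda>k. prob (stay (F k) \<phi>)) \<longlonglongrightarrow> prob (\<Union>k. stay (F k) \<phi>)"
      by (rule finite_Lim_measure_incseq[OF events])
        (use F(2) in \<open>fastforce simp: incseq_def stay_def\<close>)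
    also have "prob (\<Union>k. stay (F k) \<phi>) = prob (stay E \<phi>)"
    proof (rule finite_measure_eq_AE)
      show "AE x in M. x \<in> (\<Union>k. stay (F k) \<phi>) \<longleftrightarrow> x \<in> stay E \<phi>"
        using exhaust[OF orb] by eventually_elim (auto simp: stay_def)
    qed (use events stay_events[OF E \<phi>] in auto)
    finally show ?thesis .
  qed
  then have "(\<lambda>k. ret (F k) n) \<longlonglongrightarrow> ret E n"
    unfolding ret_def avg_def
    by (intro integral_dominated_convergence[where w = "\<lambda>_. 1"]) (auto simp: AE_measure_pmf_iff)
  then show ?thesis using le by (intro LIMSEQ_le_const2) auto
qed

lemma ret_finite_classes_le:
  assumes E: "eq_rel_over M E" and fin: "AE x in M. finite (E `` {x})"
    and \<rho>: "(\<lambda>n. ret (Id_on (space M)) n powr (1 / real (2 * n))) \<longlonglongrightarrow> \<rho>"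
  shows "ret E n \<le> \<rho> ^ (2 * n)"
proof (rule ret_exhaustion_le[where F = "trunc E"])
  have Em: "E \<in> sets (M \<Otimes>\<^sub>M M)" using E by (simp add: eq_rel_over_def)
  then show "E \<in> sets (M \<Otimes>\<^sub>M M)" .
  show "incseq (trunc E)" by (rule trunc_incseq)
  fix m
  show "trunc E m \<in> sets (M \<Otimes>\<^sub>M M)"
    using trunc_eq_rel[OF E] by (simp add: eq_rel_over_def)
  show "ret (trunc E m) n \<le> \<rho> ^ (2 * n)"
    by (rule log_convex_absorb_constant[OF ret_0[OF trunc_eq_rel[OF E]] ret_nonneg ret_le_1
          ret_log_convex[OF trunc_eq_rel[OF E]] _ ret_nonneg ret_trunc_le[OF Em] \<rho>]) simp
next
  fix \<phi> assume orb: "\<phi> \<in> orb"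
  then have \<phi>: "\<phi> \<in> carrier \<Phi>" using orb_carrier by blast
  have equiv: "equiv (space M) E" using E by (simp add: eq_rel_over_def)
  \<comment> \<open>A finite class meets the orbit in finitely many points, all of which occur among the images
    under an initial part of the enumeration.\<close>
  have core: "AE x in M. \<exists>m. x \<in> core E m"
    using fin AE_space
  proof eventually_elim
    case (elim x)
    have "\<exists>i. y = rep (gen i) x" if "y \<in> (\<lambda>\<phi>. rep \<phi> x) ` orb" for y
      using that from_nat_into_surj[OF orb_countable] by blast
    then obtain idx where idx: "\<And>y. y \<in> (\<lambda>\<phi>. rep \<phi> x) ` orb \<Longrightarrow> y = rep (gen (idx y)) x"
      by metis
    obtain m where m: "\<And>y. y \<in> E `` {x} \<Longrightarrow> idx y < m"
      using elim(1) finite_nat_set_iff_bounded[of "idx ` (E `` {x})"] by auto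
    have "x \<in> core E m"
      unfolding core_def using elim(2) m idx by blast
    then show ?case ..
  qed
  show "AE x in M. (x, rep \<phi> x) \<in> E \<longleftrightarrow> (\<exists>m. (x, rep \<phi> x) \<in> trunc E m)"
    \<comment> \<open>Both \<open>x\<close> and \<open>\<phi> x\<close> have to lie in a core, hence null sets are pulled back along \<open>\<phi>\<close>.\<close>
    using core AE_rep[OF \<phi> core] AE_space
  proof eventually_elim
    case (elim x)
    then obtain k l where kl: "x \<in> core E k" "rep \<phi> x \<in> core E l" by blast
    then have "x \<in> core E (max k l)" "rep \<phi> x \<in> core E (max k l)"
      using core_mono[of k "max k l" E] core_mono[of l "max k l" E] by auto
    moreover have "(x, x) \<in> E" using equiv elim(3) by (auto simp: equiv_def refl_on_def)
    ultimately show ?case by (auto simp: trunc_def)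
  qed
qed

lemma ret_hyperfinite_le:
  assumes S: "eq_rel_over M S" and hyp: "hyperfinite_rel M S"
    and \<rho>: "(\<lambda>n. ret (Id_on (space M)) n powr (1 / real (2 * n))) \<longlonglongrightarrow> \<rho>"
  shows "ret S n \<le> \<rho> ^ (2 * n)"
proof -
  obtain T where T: "incseq T" "\<And>k. eq_rel_over M (T k)" "\<And>k. AE x in M. finite (T k `` {x})"
    "AE x in M. S `` {x} = (\<Union>k. T k) `` {x}"
    using hyp unfolding hyperfinite_rel_def by blast
  show ?thesis
  proof (rule ret_exhaustion_le[OF _ T(1)])
    show "T k \<in> sets (M \<Otimes>\<^sub>M M)" for k using T(2) by (simp add: eq_rel_over_def)
    show "S \<in> sets (M \<Otimes>\<^sub>M M)" using S by (simp add: eq_rel_over_def)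
    show "ret (T k) n \<le> \<rho> ^ (2 * n)" for k
      by (rule ret_finite_classes_le[OF T(2,3) \<rho>])
    show "AE x in M. (x, rep \<phi> x) \<in> S \<longleftrightarrow> (\<exists>k. (x, rep \<phi> x) \<in> T k)" for \<phi>
      using T(4)
    proof eventually_elim
      case (elim x)
      have "(x, rep \<phi> x) \<in> S \<longleftrightarrow> rep \<phi> x \<in> S `` {x}" by simp
      then show ?case unfolding elim by blast
    qed
  qed
qed

lemma rel_spectral_radius_eqI:
  assumes "E \<in> sets (M \<Otimes>\<^sub>M M)" "(\<lambda>n. ret E n powr (1 / real (2 * n))) \<longlonglongrightarrow> r"
  shows "rel_spectral_radius M R E \<nu> = r"
  unfolding rel_spectral_radius_def integral_return_prob[OF assms(1) support]
  using assms(2) by (intro limI) (simp add: ret_def)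

theorem spectral_radius_hyperfinite:
  assumes S: "eq_rel_over M S" and hyp: "hyperfinite_rel M S"
  shows "spectral_radius M R \<nu> = rel_spectral_radius M R S \<nu>"
proof -
  let ?D = "Id_on (space M)"
  note D = diagonal_eq_rel
  obtain \<rho> where \<rho>: "(\<lambda>n. ret ?D n powr (1 / real (2 * n))) \<longlonglongrightarrow> \<rho>" "0 \<le> \<rho>"
    using log_convex_root_tendsto[of "ret ?D", OF ret_0[OF D] ret_nonneg ret_le_1 ret_log_convex[OF D]]
    by metis
  obtain \<sigma> where \<sigma>: "(\<lambda>n. ret S n powr (1 / real (2 * n))) \<longlonglongrightarrow> \<sigma>"
    using log_convex_root_tendsto[of "ret S", OF ret_0[OF S] ret_nonneg ret_le_1 ret_log_convex[OF S]]
    by metis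
  have Sm: "S \<in> sets (M \<Otimes>\<^sub>M M)" and DS: "?D \<subseteq> S"
    using S by (auto simp: eq_rel_over_def equiv_def refl_on_def)
  have "\<rho> \<le> \<sigma>"
  proof (rule LIMSEQ_le[OF \<rho>(1) \<sigma>], intro exI allI impI)
    fix n
    have "ret ?D n \<le> ret S n" unfolding ret_def by (rule avg_mono[OF DS Sm walk_carrier])
    then show "ret ?D n powr (1 / real (2 * n)) \<le> ret S n powr (1 / real (2 * n))"
      using ret_nonneg by (intro powr_mono2) auto
  qed
  moreover have "\<sigma> \<le> \<rho>"
  proof (rule LIMSEQ_le_const2[OF \<sigma>], intro exI[of _ 1] allI impI)
    \<comment> \<open>The term for \<open>n = 0\<close> is 1 by convention and has to be left out.\<close>
    fix n :: nat assume n: "1 \<le> n"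
    have "ret S n powr (1 / real (2 * n)) \<le> (\<rho> ^ (2 * n)) powr (1 / real (2 * n))"
      using ret_nonneg ret_hyperfinite_le[OF S hyp \<rho>(1)] by (intro powr_mono2) auto
    also have "\<dots> = \<rho>"
    proof (cases "\<rho> = 0")
      case False
      then have "\<rho> ^ (2 * n) = \<rho> powr real (2 * n)"
        using \<rho>(2) by (intro powr_realpow[symmetric]) simp
      then show ?thesis using n \<rho>(2) by (simp add: powr_powr)
    qed (use n in simp)
    finally show "ret S n powr (1 / real (2 * n)) \<le> \<rho>" .
  qed
  ultimately have "\<rho> = \<sigma>" by simp
  then show ?thesis
    using rel_spectral_radius_eqI[OF diagonal_sets \<rho>(1)] rel_spectral_radius_eqI[OF Sm \<sigma>]
    by (simp add: spectral_radius_def)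
qed

end

theorem proposition4p1:
  fixes M :: "'a measure" and R S :: "('a \<times> 'a) set" and \<nu> :: "('a \<Rightarrow> 'a) set pmf"
  assumes "standard_prob_space M"
    and "eq_rel_over M R" and "discrete_rel M R" and "measure_preserving_rel M R"
    and "ergodic_rel M R"
    and "countably_supported_prob (full_group M R) \<nu>"
    and "symmetric_pmf (full_group M R) \<nu>"
    and "eq_rel_over M S" and "S \<subseteq> R"
    and "hyperfinite_rel M S"
  shows "spectral_radius M R \<nu> = rel_spectral_radius M R S \<nu>"
proof -
  interpret pmp_random_walk M R \<nu>
    using assms
    by (intro pmp_random_walk.intro pmp_relation.intro pmp_random_walk_axioms.intro)
      (auto simp: countably_supported_prob_def)
  show ?thesis
    by (rule spectral_radius_hyperfinite) (fact assms)+
qed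

end
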